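(* Let $\mu$ be the Möbius function and assume that Elliott's conjecture holds, that is, for every integer $h\ge 0$, $$\lim_{N\to+\infty}\frac1N\sum_{n=1}^{N}\mu(n)\mu(n+h)=\begin{cases}0 & \text{if } h\ne 0,\\ \dfrac{6}{\pi^2} & \text{if } h=0.\end{cases}$$ Let $(X,T)$ be a uniquely ergodic dynamical system with invariant probability measure $P$ and with singular spectrum. Then for every $f\in C_0(X)$ and every $x\in X$, $$\frac1N\sum_{n=1}^{N}f(T^n x)\,\mu(n)\longrightarrow 0\quad\text{as } N\to+\infty .$$
   Context: The Möbius function is $\mu(1)=1$, $\mu(n)=(-1)^r$ if $n$ is a product of $r$ distinct primes, and $\mu(n)=0$ otherwise. $(X,T)$ is uniquely ergodic if $X$ is a compact metric space, $T:X\to X$ is a homeomorphism and there is a unique ergodic $T$-invariant Borel probability measure $P$ on $X$. $C_0(X)$ is the set of continuous complex-valued functions $f$ on $X$ with zero mean, $\int f\,dP=0$. For $f\in L^2(X,P)$ the spectral measure $\sigma_f$ is the finite positive measure on the circle with $\int e^{-ikx}\,d\sigma_f(x)=\int_X f\circ T^k\cdot\overline f\,dP$ for all $k\in\mathbb{Z}$. The maximal spectral type of $T$ is the equivalence class of a measure $\sigma_{f_1}$ ($f_1\in L^2(X,P)$) with respect to which all $\sigma_f$, $f\in L^2(X,P)$, are absolutely continuous. $T$ has singular spectrum if $\sigma_{f_1}$ is singular with respect to Lebesgue measure on the circle. *)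

theory Defs
  imports "HOL-Probability.Probability" "HOL-Computational_Algebra.Squarefree"
begin

section \<open>The Moebius function\<close>

definition moebius_mu :: "nat \<Rightarrow> int" where
  "moebius_mu n = (if squarefree n then (-1) ^ card (prime_factors n) else 0)"

lemma moebius_mu_1: "moebius_mu 1 = 1"
  by (simp add: moebius_mu_def)

lemma moebius_mu_prod_primes:
  assumes "finite A" and "\<And>p. p \<in> A \<Longrightarrow> prime p"
  shows "moebius_mu (\<Prod>A) = (-1) ^ card A"
proof -
  have "squarefree (\<Prod>A)"
    using assms by (intro squarefree_prod_coprime) (auto intro: primes_coprime squarefree_prime)
  moreover have "prime_factors (\<Prod>A) = A"
  proof -
    have "p \<in> A" if "prime p" "p dvd \<Prod>A" for p
      using that assms by (metis prime_dvd_prod_iff primes_dvd_imp_eq)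
    moreover have "\<Prod>A \<noteq> 0" using assms not_prime_0 by (metis prod_zero_iff)
    ultimately show ?thesis
      using assms by (auto simp: prime_factors_dvd intro: dvd_prodI)
  qed
  ultimately show ?thesis by (simp add: moebius_mu_def)
qed

lemma moebius_mu_eq_0:
  assumes "\<nexists>A. finite A \<and> (\<forall>p\<in>A. prime p) \<and> n = \<Prod>A"
  shows "moebius_mu n = 0"
proof -
  have False if sq: "squarefree n"
  proof -
    have "n \<noteq> 0" using sq by (metis not_squarefree_0)
    then have "n = (\<Prod>p\<in>prime_factors n. p ^ multiplicity p n)"
      by (simp add: prime_factorization_nat)
    also have "\<dots> = \<Prod>(prime_factors n)"
    proof (rule prod.cong)
      fix p assume "p \<in> prime_factors n"
      then have "multiplicity p n = 1"
        using sq \<open>n \<noteq> 0\<close> by (simp add: squarefree_factorial_semiring' del: One_nat_def)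
      then show "p ^ multiplicity p n = p" by simp
    qed simp
    finally show False using assms by auto
  qed
  then show ?thesis by (auto simp: moebius_mu_def)
qed

section \<open>Uniquely ergodic systems\<close>

text \<open>Borel probability measures on \<^typ>\<open>'a\<close> that are invariant and ergodic under T.\<close>

definition ergodic_measure :: "('a::topological_space \<Rightarrow> 'a) \<Rightarrow> 'a measure \<Rightarrow> bool" where
  "ergodic_measure T P \<longleftrightarrow>
     prob_space P \<and> sets P = sets borel \<and>
     T \<in> measurable P P \<and> distr P P T = P \<and>
     (\<forall>A\<in>sets P. T -` A = A \<longrightarrow> measure P A = 0 \<or> measure P A = 1)"

definition uniquely_ergodic :: "('a::metric_space \<Rightarrow> 'a) \<Rightarrow> 'a measure \<Rightarrow> bool" where
  "uniquely_ergodic T P \<longleftrightarrow>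
     compact (UNIV :: 'a set) \<and>
     (\<exists>S. homeomorphism UNIV UNIV T S) \<and>
     ergodic_measure T P \<and> (\<forall>Q. ergodic_measure T Q \<longrightarrow> Q = P)"

text \<open>Continuous functions of zero mean.\<close>

definition C0 :: "'a::topological_space measure \<Rightarrow> ('a \<Rightarrow> complex) set" where
  "C0 P = {f. continuous_on UNIV f \<and> (\<integral>x. f x \<partial>P) = 0}"

section \<open>Spectral measures\<close>

text \<open>Functions representing the elements of the complex space of square-integrable
  functions; they are not identified up to null sets.\<close>

definition L2 :: "'a measure \<Rightarrow> ('a \<Rightarrow> complex) set" where
  "L2 P = {f \<in> borel_measurable P. integrable P (\<lambda>x. (norm (f x))\<^sup>2)}"

text \<open>Integer iterates; used for bijective T only.\<close>

definition iter :: "('a \<Rightarrow> 'a) \<Rightarrow> int \<Rightarrow> 'a \<Rightarrow> 'a" where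
  "iter T k = (if k \<ge> 0 then T ^^ nat k else inv T ^^ nat (- k))"

text \<open>The circle is the group of reals modulo \<open>2 * pi\<close>, represented by the fundamental
  domain \<open>{0..<2 * pi}\<close> with the Borel sets of the line (these agree with the Borel sets of the
  circle).\<close>

definition circle_borel :: "real measure" where
  "circle_borel = restrict_space borel {0..<2 * pi}"

definition circle_lebesgue :: "real measure" where
  "circle_lebesgue = restrict_space lborel {0..<2 * pi}"

text \<open>The measure \<open>\<sigma>\<close> is the spectral measure of f; here \<open>cis (- (k * t))\<close> is
  \<open>exp (- \<i> * k * t)\<close>.\<close>

definition is_spectral_measure ::
    "('a \<Rightarrow> 'a) \<Rightarrow> 'a measure \<Rightarrow> ('a \<Rightarrow> complex) \<Rightarrow> real measure \<Rightarrow> bool" where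
  "is_spectral_measure T P f \<sigma> \<longleftrightarrow>
     sets \<sigma> = sets circle_borel \<and> finite_measure \<sigma> \<and>
     (\<forall>k::int. (\<integral>t. cis (- (of_int k * t)) \<partial>\<sigma>) = (\<integral>x. f (iter T k x) * cnj (f x) \<partial>P))"

text \<open>The measure \<open>\<sigma>\<close> is a spectral measure lying in the maximal spectral type.
  Recall that \<open>absolutely_continuous M N\<close> says that N is absolutely continuous with
  respect to M.\<close>

definition maximal_spectral_measure ::
    "('a \<Rightarrow> 'a) \<Rightarrow> 'a measure \<Rightarrow> real measure \<Rightarrow> bool" where
  "maximal_spectral_measure T P \<sigma> \<longleftrightarrow>
     (\<exists>f\<^sub>1\<in>L2 P. is_spectral_measure T P f\<^sub>1 \<sigma>) \<and>
     (\<forall>f\<in>L2 P. \<forall>\<tau>. is_spectral_measure T P f \<tau> \<longrightarrow> absolutely_continuous \<sigma> \<tau>)"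

definition mutually_singular :: "'a measure \<Rightarrow> 'a measure \<Rightarrow> bool" where
  "mutually_singular M N \<longleftrightarrow>
     sets M = sets N \<and> (\<exists>A\<in>sets M. emeasure M A = 0 \<and> emeasure N (space N - A) = 0)"

text \<open>Singularity depends only on the equivalence class of the measure, so it does not matter
  which representative of the maximal spectral type is used.\<close>

definition singular_spectrum :: "('a \<Rightarrow> 'a) \<Rightarrow> 'a measure \<Rightarrow> bool" where
  "singular_spectrum T P \<longleftrightarrow>
     (\<exists>\<sigma>. maximal_spectral_measure T P \<sigma> \<and> mutually_singular \<sigma> circle_lebesgue)"

end

theory Submission
  imports Defs
begin

text \<open>Let \<open>\<tau>\<close> be the spectral measure of f and w the character \<open>cis (- t)\<close>. As \<open>\<tau>\<close> is singular, there
  is a trigonometric polynomial q that is close to 1 in the quadratic mean for \<open>\<tau>\<close> and close to 0 in the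
  quadratic mean for Lebesgue measure. Replacing the powers of w in q by powers of T splits f into
  \<open>(1 - q)(T) f\<close>, which by unique ergodicity has small quadratic mean along every orbit, and
  \<open>q(T) f\<close>. In the correlation of the latter with the Moebius function, a change of index moves the
  shifts to the Moebius function, and Elliott's conjecture says that the spectral measure of the
  Moebius function is a multiple of Lebesgue measure, so the filtered Moebius function has small
  quadratic mean. Both parts are finished by the Cauchy-Schwarz inequality.\<close>

section \<open>Weak compactness of probability measures on a compact metric space\<close>

text \<open>The claim concerns every single point, whereas spectral information holds only in
  quadratic mean for \<open>P\<close>. Unique ergodicity bridges the gap for continuous functions
  only, so cutting f with an indicator function on the spectral side, natural for a statement in
  quadratic mean, is not admissible. A polynomial in T keeps the remainder continuous, and its
  finitely many shifts change an orbit sum by a bounded amount, which the division by N removes.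

  Two features of the definitions cause much of the remaining work. Uniqueness is given among
  ergodic measures, but limits of orbit averages are merely invariant, so uniqueness has to be
  extended to invariant measures; weak compactness enters there. And maximality of the spectral type
  speaks about spectral measures of f without asserting that one exists, so one is constructed for
  continuous f by Herglotz' theorem.

  Negative powers of w in q are cleared by a factor w^K: f composed with T^K is compared with a
  genuine polynomial in T applied to f, and the orbit starts K steps earlier.\<close>

lemma compact_dense_sequence:
  assumes "compact (UNIV :: 'a::metric_space set)"
  obtains d :: "nat \<Rightarrow> 'a::metric_space" where "\<And>x e. e > 0 \<Longrightarrow> \<exists>i. dist x (d i) < e"
proof -
  have "\<forall>n. \<exists>k. finite k \<and> (UNIV :: 'a set) \<subseteq> (\<Union>x\<in>k. ball x (1 / Suc n))"
    using assms unfolding compact_eq_totally_bounded by (metis of_nat_0_less_iff zero_less_Suc zero_less_divide_1_iff)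
  then obtain k where k: "\<And>n. finite (k n)" "\<And>n. (UNIV :: 'a set) \<subseteq> (\<Union>x\<in>k n. ball x (1 / Suc n))"
    by metis
  let ?D = "\<Union>n. k n"
  have cD: "countable ?D" using k(1) by (auto intro: countable_finite)
  have near: "\<exists>y\<in>?D. dist x y < e" if "e > 0" for x e
  proof -
    obtain n where "1 / Suc n < e" using \<open>e > 0\<close> nat_approx_posE by blast
    moreover obtain y where "y \<in> k n" "x \<in> ball y (1 / Suc n)" using k(2)[of n] by blast
    ultimately show ?thesis by (auto simp: dist_commute intro!: bexI[of _ y])
  qed
  then have "?D \<noteq> {}" using zero_less_one by blast
  then have "range (from_nat_into ?D) = ?D" using cD by (rule range_from_nat_into)
  with near show ?thesis using that[of "from_nat_into ?D"] by (metis rangeE)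
qed

section \<open>Countable families of test functions that determine a measure\<close>

lemma continuous_on_prod_list:
  fixes f :: "'b \<Rightarrow> 'a::topological_space \<Rightarrow> real"
  assumes "\<And>p. p \<in> set l \<Longrightarrow> continuous_on S (f p)"
  shows "continuous_on S (\<lambda>x. \<Prod>p\<leftarrow>l. f p x)"
  using assms by (induction l) (auto intro!: continuous_intros)

text \<open>Countability and the bounds 0 and 1 make it possible to combine all the integrals of a
  measure into one convergent series, the functional \<open>\<Phi>\<close> used later.\<close>

definition determining_sequence :: "(nat \<Rightarrow> 'a::topological_space \<Rightarrow> real) \<Rightarrow> bool" where
  "determining_sequence g \<longleftrightarrow>
     (\<forall>i. continuous_on UNIV (g i)) \<and> (\<forall>i x. 0 \<le> g i x \<and> g i x \<le> 1) \<and>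
     (\<forall>M N. prob_space M \<longrightarrow> prob_space N \<longrightarrow> sets M = sets borel \<longrightarrow> sets N = sets borel \<longrightarrow>
       (\<forall>i. (\<integral>x. g i x \<partial>M) = (\<integral>x. g i x \<partial>N)) \<longrightarrow> M = N)"

text \<open>The tent functions \<open>u\<close> are positive exactly on small balls around the
  points of a dense sequence. Products over lists are positive exactly on finite intersections of
  these balls, so the sets \<open>U l\<close> form a countable base; concatenation of lists makes it
  stable under intersection, and the empty list gives the whole space. As m grows,
  \<open>h (l, m)\<close> increases to the indicator of \<open>U l\<close>, so the integrals
  determine the measure on a generating system stable under intersection, hence everywhere.\<close>

lemma determining_sequence_exists:
  assumes "compact (UNIV :: 'a::metric_space set)"
  obtains g :: "nat \<Rightarrow> 'a::metric_space \<Rightarrow> real" where "determining_sequence g"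
proof -
  obtain d :: "nat \<Rightarrow> 'a" where d: "\<And>x e. e > 0 \<Longrightarrow> \<exists>i. dist x (d i) < e"
    using compact_dense_sequence[OF assms] by blast
  define u where "u = (\<lambda>(i, n) x. max 0 (1 / Suc n - dist x (d i)))"
  define v where "v l x = (\<Prod>p\<leftarrow>l. u p x)" for l x
  define h where "h = (\<lambda>(l, m) x. min 1 (real m * v l x))"
  define U where "U l = {x. v l x > 0}" for l
  have u0: "u p x \<ge> 0" for p x by (auto simp: u_def split: prod.split)
  have v0: "v l x \<ge> 0" for l x unfolding v_def using u0 by (induction l) auto
  have cu: "continuous_on UNIV (u p)" for p
    by (auto simp: u_def split: prod.split intro!: continuous_intros)
  have cv: "continuous_on UNIV (v l)" for l
    unfolding v_def[abs_def] by (rule continuous_on_prod_list) (rule cu)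
  have ch: "continuous_on UNIV (h q)" for q
    using cv by (auto simp: h_def split: prod.split intro!: continuous_intros)
  have h0: "0 \<le> h q x" "h q x \<le> 1" for q x
    using v0 by (auto simp: h_def split: prod.split)
  have U_append: "U (l @ l') = U l \<inter> U l'" for l l'
    using v0[of l] v0[of l'] by (auto simp: U_def v_def zero_less_mult_iff less_le)
  have openU: "open (U l)" for l
    unfolding U_def using cv by (intro open_Collect_less) auto
  have borel_eq: "sets (borel :: 'a measure) = sigma_sets UNIV (range U)"
  proof
    have sub: "open S \<Longrightarrow> S \<in> sigma_sets UNIV (range U)" for S :: "'a set"
    proof -
      assume S: "open S"
      have "S = (\<Union>l\<in>{l. U l \<subseteq> S}. U l)"
      proof -
        have "\<exists>l. U l \<subseteq> S \<and> x \<in> U l" if "x \<in> S" for x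
        proof -
          obtain e where e: "e > 0" "ball x e \<subseteq> S" using S \<open>x \<in> S\<close> openE by blast
          obtain n where n: "1 / Suc n < e / 2" using e nat_approx_posE[of "e/2"] by auto
          obtain i where i: "dist x (d i) < 1 / Suc n" using d[of "1 / Suc n"] by auto
          have "x \<in> U [(i, n)]" using i by (simp add: U_def v_def u_def)
          moreover have "U [(i, n)] \<subseteq> ball x e"
          proof
            fix y assume "y \<in> U [(i, n)]"
            then have "dist y (d i) < 1 / Suc n" by (auto simp: U_def v_def u_def)
            then show "y \<in> ball x e" using i n dist_triangle2[of x y "d i"] by (simp add: dist_commute)
          qed
          ultimately show ?thesis using e by blast
        qed
        then show ?thesis by blast
      qed
      also have "\<dots> \<in> sigma_sets UNIV (range U)"
        by (intro sigma_sets_UNION) (auto intro: countable_image)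
      finally show ?thesis .
    qed
    show "sets (borel :: 'a measure) \<subseteq> sigma_sets UNIV (range U)"
      unfolding sets_borel by (intro sigma_sets_mono) (use sub in auto)
    show "sigma_sets UNIV (range U) \<subseteq> sets (borel :: 'a measure)"
      using openU by (metis (no_types, lifting) borel_open image_subsetI sets.sigma_sets_subset space_borel)
  qed
  have lim: "(\<lambda>m. \<integral>x. h (l, m) x \<partial>M) \<longlonglongrightarrow> measure M (U l)"
    if M: "prob_space M" "sets M = sets borel" for M l
  proof -
    interpret prob_space M by fact
    have "U l \<in> sets M" using openU[of l] by (simp add: M(2))
    have "(\<lambda>m. \<integral>x. h (l, m) x \<partial>M) \<longlonglongrightarrow> (\<integral>x. indicator (U l) x \<partial>M)"
    proof (rule integral_dominated_convergence[where w="\<lambda>_. 1"])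
      show "(\<lambda>x. indicat_real (U l) x) \<in> borel_measurable M"
        using \<open>U l \<in> sets M\<close> by (rule borel_measurable_indicator)
      show "h (l, m) \<in> borel_measurable M" for m
        using borel_measurable_continuous_onI[OF ch] by (simp add: measurable_cong_sets[OF M(2) refl])
      show "AE x in M. (\<lambda>m. h (l, m) x) \<longlonglongrightarrow> indicat_real (U l) x"
      proof (rule AE_I2)
        fix x
        show "(\<lambda>m. h (l, m) x) \<longlonglongrightarrow> indicat_real (U l) x"
        proof (cases "x \<in> U l")
          case True
          then have "v l x > 0" by (simp add: U_def)
          then obtain m0 where "real m0 * v l x > 1" using reals_Archimedean3 by blast
          then have "\<forall>m\<ge>m0. h (l, m) x = 1"
            using \<open>v l x > 0\<close> unfolding h_def
            by (smt (verit, best) case_prod_conv mult_right_mono of_nat_mono)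
          then show ?thesis using True
            by (intro tendsto_eventually) (auto simp: eventually_sequentially)
        next
          case False
          then show ?thesis using v0[of l x] by (simp add: U_def h_def)
        qed
      qed
    qed (use h0 in auto)
    then show ?thesis using \<open>U l \<in> sets M\<close> by simp
  qed
  have det: "M = N" if "prob_space M" "prob_space N" "sets M = sets borel" "sets N = sets borel"
    "\<And>q. (\<integral>x. h q x \<partial>M) = (\<integral>x. h q x \<partial>N)" for M N
  proof (rule measure_eqI_generator_eq[where E="range U" and \<Omega>=UNIV and A="\<lambda>_. UNIV"])
    interpret M: prob_space M by fact
    interpret N: prob_space N by fact
    show "Int_stable (range U)"
    proof (rule Int_stableI)
      fix a b assume "a \<in> range U" "b \<in> range U"
      then obtain l l' where "a = U l" "b = U l'" by blast
      then show "a \<inter> b \<in> range U" using U_append[of l l'] by blast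
    qed
    show "sets M = sigma_sets UNIV (range U)" "sets N = sigma_sets UNIV (range U)"
      using that borel_eq by auto
    show "emeasure M X = emeasure N X" if XU: "X \<in> range U" for X
    proof -
      obtain l where X: "X = U l" using XU by blast
      have "measure M (U l) = measure N (U l)"
        using lim[of M l] lim[of N l] \<open>prob_space M\<close> \<open>prob_space N\<close> \<open>sets M = sets borel\<close>
          \<open>sets N = sets borel\<close> \<open>\<And>q. (\<integral>x. h q x \<partial>M) = (\<integral>x. h q x \<partial>N)\<close>
        by (metis (no_types, lifting) LIMSEQ_unique ext)
      then show ?thesis by (simp add: X M.emeasure_eq_measure N.emeasure_eq_measure)
    qed
    have "UNIV = U []" by (auto simp: U_def v_def)
    then show "range (\<lambda>_::nat. UNIV) \<subseteq> range U" by auto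
    show "emeasure M UNIV \<noteq> \<infinity>" by simp
  qed auto
  show thesis
  proof (rule that[of "\<lambda>i. h (from_nat i)"])
    show "determining_sequence (\<lambda>i. h (from_nat i))"
      unfolding determining_sequence_def
    proof (intro conjI allI impI)
      fix M N :: "'a measure"
      assume A: "prob_space M" "prob_space N" "sets M = sets borel" "sets N = sets borel"
        "\<forall>i. (\<integral>x. h (from_nat i) x \<partial>M) = (\<integral>x. h (from_nat i) x \<partial>N)"
      have "(\<integral>x. h q x \<partial>M) = (\<integral>x. h q x \<partial>N)" for q
        using A(5)[rule_format, of "to_nat q"] by simp
      with A show "M = N" using det by blast
    qed (use ch h0 in auto)
  qed
qed

section \<open>Coding the points of a compact metric space by real numbers\<close>

definition binary_code :: "(nat \<Rightarrow> bool) \<Rightarrow> real" where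
  "binary_code a = (\<Sum>i. of_bool (a i) / 3 ^ i)"

lemma summable_binary_code: "summable (\<lambda>i. of_bool (a i) / 3 ^ i :: real)"
proof (rule summable_comparison_test')
  show "summable (\<lambda>i. (1/3) ^ i :: real)" by (rule summable_geometric) auto
  show "norm (of_bool (a i) / 3 ^ i :: real) \<le> (1/3) ^ i" for i
    by (simp add: power_one_over)
qed

lemma binary_code_bounds: "0 \<le> binary_code a" "binary_code a \<le> 3 / 2"
proof -
  show "0 \<le> binary_code a"
    unfolding binary_code_def by (intro suminf_nonneg summable_binary_code) auto
  have "binary_code a \<le> (\<Sum>i. (1/3) ^ i)"
    unfolding binary_code_def
    by (intro suminf_le summable_binary_code summable_geometric) (auto simp: power_one_over)
  also have "\<dots> = 3 / 2" by (subst suminf_geometric) auto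
  finally show "binary_code a \<le> 3 / 2" .
qed

lemma binary_code_shift: "binary_code a = of_bool (a 0) + binary_code (\<lambda>i. a (Suc i)) / 3"
proof -
  have "binary_code a = of_bool (a 0) + (\<Sum>i. of_bool (a (Suc i)) / 3 ^ Suc i)"
    unfolding binary_code_def using suminf_split_head[OF summable_binary_code[of a]] by simp
  also have "(\<Sum>i. of_bool (a (Suc i)) / 3 ^ Suc i) = (\<Sum>i. (of_bool (a (Suc i)) / 3 ^ i) / 3 :: real)"
    by (simp add: mult.commute)
  also have "\<dots> = binary_code (\<lambda>i. a (Suc i)) / 3"
    unfolding binary_code_def by (intro suminf_divide summable_binary_code)
  finally show ?thesis .
qed

text \<open>This is why 0-1 sequences are read in base 3, as points of a Cantor set: all digits
  after position i contribute at most half of \<open>1 / 3 ^ i\<close>, so they cannot make up for a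
  difference in digit i, as they could in base 2. The induction strips the leading digit, which
  triples the remaining distance.\<close>

lemma binary_code_close:
  assumes "\<bar>binary_code a - binary_code b\<bar> < 1 / (2 * 3 ^ n)" "i \<le> n"
  shows "a i = b i"
  using assms
proof (induction n arbitrary: a b i)
  case (0 a b i)
  then show ?case
    using binary_code_shift[of a] binary_code_shift[of b] binary_code_bounds[of "\<lambda>i. a (Suc i)"]
      binary_code_bounds[of "\<lambda>i. b (Suc i)"] by (cases "a 0"; cases "b 0") auto
next
  case (Suc n a b i)
  have "(1::real) \<le> 3 ^ Suc n" by (rule one_le_power) simp
  then have "1 / (2 * 3 ^ Suc n) \<le> (1 / 2 :: real)" by (simp add: field_simps)
  then have *: "\<bar>binary_code a - binary_code b\<bar> < 1 / 2" using Suc.prems by linarith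
  then have a0: "a 0 = b 0"
    using binary_code_shift[of a] binary_code_shift[of b] binary_code_bounds[of "\<lambda>i. a (Suc i)"]
      binary_code_bounds[of "\<lambda>i. b (Suc i)"] by (cases "a 0"; cases "b 0") auto
  show ?case
  proof (cases i)
    case 0
    then show ?thesis using a0 by simp
  next
    case (Suc j)
    have "\<bar>binary_code a - binary_code b\<bar> =
        \<bar>binary_code (\<lambda>i. a (Suc i)) - binary_code (\<lambda>i. b (Suc i))\<bar> / 3"
      unfolding binary_code_shift[of a] binary_code_shift[of b] by (simp add: a0 flip: diff_divide_distrib)
    then have "\<bar>binary_code (\<lambda>i. a (Suc i)) - binary_code (\<lambda>i. b (Suc i))\<bar> / 3 < 1 / (2 * 3 ^ n) / 3"
      using Suc.prems by simp
    then have "\<bar>binary_code (\<lambda>i. a (Suc i)) - binary_code (\<lambda>i. b (Suc i))\<bar> < 1 / (2 * 3 ^ n)"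
      by (simp add: divide_less_cancel del: divide_divide_eq_left)
    from Suc.IH[OF this, of j] show ?thesis using Suc Suc.prems by simp
  qed
qed

text \<open>The code of a point records which members of a sequence of small balls contain it. It is
  injective with uniformly continuous inverse, although it is only Borel measurable.\<close>

lemma compact_coding_exists:
  assumes "compact (UNIV :: 'a::metric_space set)"
  obtains s :: "'a::metric_space \<Rightarrow> real"
  where "s \<in> borel_measurable borel" "\<And>x. 0 \<le> s x" "\<And>x. s x \<le> 3 / 2"
    "\<And>e. e > 0 \<Longrightarrow> \<exists>d>0. \<forall>x y. \<bar>s x - s y\<bar> < d \<longrightarrow> dist x y < e"
proof -
  have "\<forall>n. \<exists>k. finite k \<and> (UNIV :: 'a set) \<subseteq> (\<Union>x\<in>k. ball x (1 / Suc n))"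
    using assms unfolding compact_eq_totally_bounded
    by (metis of_nat_0_less_iff zero_less_Suc zero_less_divide_1_iff)
  then obtain k where k: "\<And>n. finite (k n)" "\<And>n. (UNIV :: 'a set) \<subseteq> (\<Union>x\<in>k n. ball x (1 / Suc n))"
    by metis
  define I where "I = (SIGMA n:UNIV. k n)"
  have cI: "countable I" using k(1) by (auto simp: I_def intro: countable_finite)
  have "k 0 \<noteq> {}" using k(2)[of 0] by auto
  then have "I \<noteq> {}" by (auto simp: I_def)
  define c where "c = from_nat_into I"
  have rc: "range c = I" unfolding c_def using \<open>I \<noteq> {}\<close> cI by (rule range_from_nat_into)
  define B where "B i = ball (snd (c i)) (1 / Suc (fst (c i)))" for i
  define s where "s x = binary_code (\<lambda>i. x \<in> B i)" for x
  show thesis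
  proof (rule that[of s])
    have [measurable]: "B i \<in> sets borel" for i by (simp add: B_def)
    have "(\<lambda>x. of_bool (x \<in> B i) / 3 ^ i :: real) \<in> borel_measurable borel" for i
      by measurable
    then show "s \<in> borel_measurable borel"
      unfolding s_def binary_code_def by (intro borel_measurable_suminf)
    show "0 \<le> s x" "s x \<le> 3 / 2" for x unfolding s_def by (rule binary_code_bounds)+
    fix e :: real assume "e > 0"
    then obtain n where n: "1 / Suc n < e / 2" using nat_approx_posE[of "e/2"] by auto
    have "\<exists>i. c i = (n, x)" if "x \<in> k n" for x
    proof -
      have "(n, x) \<in> range c" using that by (simp add: rc I_def)
      then show ?thesis by (metis imageE)
    qed
    then obtain j where j: "\<And>x. x \<in> k n \<Longrightarrow> c (j x) = (n, x)" by metis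
    \<comment> \<open>The finite net of radius \<open>1 / Suc n\<close> occupies finitely many
      positions of the enumeration, all at most m. Codes agreeing up to m therefore place both
      points in a common ball of that net.\<close>
    define m where "m = Max (insert 0 (j ` k n))"
    have m: "j x \<le> m" if "x \<in> k n" for x unfolding m_def using k(1) that by (intro Max_ge) auto
    have "dist x y < e" if xy: "\<bar>s x - s y\<bar> < 1 / (2 * 3 ^ m)" for x y
    proof -
      obtain z where z: "z \<in> k n" "x \<in> ball z (1 / Suc n)" using k(2)[of n] by blast
      have "x \<in> B (j z)" using z j by (simp add: B_def)
      then have "y \<in> B (j z)"
        using binary_code_close[OF xy[unfolded s_def] m[OF z(1)]] by simp
      then have "dist z y < 1 / Suc n" using j[OF z(1)] by (simp add: B_def)
      moreover have "dist z x < 1 / Suc n" using z by simp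
      ultimately show ?thesis using n dist_triangle3[of x y z] by linarith
    qed
    then show "\<exists>d>0. \<forall>x y. \<bar>s x - s y\<bar> < d \<longrightarrow> dist x y < e"
      by (intro exI[of _ "1 / (2 * 3 ^ m)"]) auto
  qed
qed

text \<open>The inverse of s is uniformly continuous on the range of s and takes values in a
  compact, hence complete, space, so it extends to the closure. The closure is needed because weak
  limits of measures on codes may charge limit points that are not codes. The value at c is a limit
  of points whose codes tend to c, and every point with code near c is close to it.\<close>

lemma decoding_exists:
  fixes s :: "'a::metric_space \<Rightarrow> real"
  assumes "compact (UNIV :: 'a set)"
    and inv: "\<And>e. e > 0 \<Longrightarrow> \<exists>d>0. \<forall>x y. \<bar>s x - s y\<bar> < d \<longrightarrow> dist x y < e"
  obtains \<phi> :: "real \<Rightarrow> 'a"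
  where "continuous_on (closure (range s)) \<phi>" "\<And>x. \<phi> (s x) = x"
proof -
  have "\<exists>x. \<forall>e>0. \<exists>d>0. \<forall>y. \<bar>s y - c\<bar> < d \<longrightarrow> dist y x < e" if c: "c \<in> closure (range s)" for c
  proof -
    obtain u where u: "\<And>n. u n \<in> range s" "u \<longlonglongrightarrow> c" using c unfolding closure_sequential by blast
    have "\<exists>z. u n = s z" for n using u(1)[of n] by blast
    then obtain z where z: "\<And>n. u n = s (z n)" by metis
    obtain x r where r: "strict_mono r" "(z \<circ> r) \<longlonglongrightarrow> x"
      using \<open>compact UNIV\<close> unfolding compact_eq_seq_compact_metric seq_compact_def by blast
    have uc: "(\<lambda>n. s (z (r n))) \<longlonglongrightarrow> c"
      using LIMSEQ_subseq_LIMSEQ[OF u(2) r(1)] by (simp add: z o_def)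
    have "\<exists>d>0. \<forall>y. \<bar>s y - c\<bar> < d \<longrightarrow> dist y x < e" if "e > 0" for e
    proof -
      obtain d where d: "d > 0" "\<And>x y. \<bar>s x - s y\<bar> < d \<Longrightarrow> dist x y < e / 2"
        using inv[of "e/2"] \<open>e > 0\<close> by auto
      have "\<forall>\<^sub>F n in sequentially. dist (s (z (r n))) c < d / 2 \<and> dist ((z \<circ> r) n) x < e / 2"
        using d \<open>e > 0\<close> by (intro eventually_conj tendstoD[OF uc] tendstoD[OF r(2)]) auto
      then obtain n where n: "dist (s (z (r n))) c < d / 2" "dist (z (r n)) x < e / 2"
        by (auto simp: eventually_sequentially)
      have "dist y x < e" if "\<bar>s y - c\<bar> < d / 2" for y
      proof -
        have "\<bar>s y - s (z (r n))\<bar> < d" using that n(1) unfolding dist_real_def by linarith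
        from d(2)[OF this] show ?thesis using n(2) dist_triangle[of y x "z (r n)"] by linarith
      qed
      then show ?thesis using \<open>d > 0\<close> by (intro exI[of _ "d/2"]) auto
    qed
    then show ?thesis by blast
  qed
  then obtain \<phi> where \<phi>: "\<And>c e. c \<in> closure (range s) \<Longrightarrow> e > 0 \<Longrightarrow>
      \<exists>d>0. \<forall>y. \<bar>s y - c\<bar> < d \<longrightarrow> dist y (\<phi> c) < e"
    by metis
  show thesis
  proof (rule that[of \<phi>])
    show "\<phi> (s x) = x" for x
    proof -
      have "dist x (\<phi> (s x)) < e" if "e > 0" for e
      proof -
        have "s x \<in> closure (range s)" using closure_subset[of "range s"] by blast
        from \<phi>[OF this that] show ?thesis by auto
      qed
      then show ?thesis by (metis dist_pos_lt less_irrefl)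
    qed
    show "continuous_on (closure (range s)) \<phi>"
      unfolding continuous_on_iff
    proof (intro ballI allI impI)
      fix c e :: real assume c: "c \<in> closure (range s)" and "e > 0"
      obtain d where d: "d > 0" "\<And>y. \<bar>s y - c\<bar> < d \<Longrightarrow> dist y (\<phi> c) < e / 2"
        using \<phi>[OF c, of "e/2"] \<open>e > 0\<close> by auto
      have "dist (\<phi> c') (\<phi> c) < e" if c': "c' \<in> closure (range s)" and close: "dist c' c < d / 2" for c'
      proof -
        obtain d' where d': "d' > 0" "\<And>y. \<bar>s y - c'\<bar> < d' \<Longrightarrow> dist y (\<phi> c') < e / 2"
          using \<phi>[OF c', of "e/2"] \<open>e > 0\<close> by auto
        have "min (d/2) d' > 0" using d d' by simp
        then obtain y where "dist (s y) c' < min (d / 2) d'"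
          using c' unfolding closure_approachable by blast
        then have "\<bar>s y - c'\<bar> < d'" "\<bar>s y - c\<bar> < d" using close unfolding dist_real_def by linarith+
        then show ?thesis using d(2) d'(2) dist_triangle3[of "\<phi> c'" "\<phi> c" y] by fastforce
      qed
      then show "\<exists>d>0. \<forall>x'\<in>closure (range s). dist x' c < d \<longrightarrow> dist (\<phi> x') (\<phi> c) < e"
        using \<open>d > 0\<close> by (intro exI[of _ "d/2"]) auto
    qed
  qed
qed

section \<open>Sequential compactness carried over from the real line\<close>

lemma weak_limit_closed_support:
  assumes "\<And>n. real_distribution (M n)" "real_distribution N" "weak_conv_m M N"
    and "closed C" "C \<noteq> {}" "\<And>n. AE t in M n. t \<in> C"
  shows "AE t in N. t \<in> C"
proof -
  interpret N: real_distribution N by fact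
  \<comment> \<open>A bounded continuous test function whose zero set is exactly the closed set
    C.\<close>
  define h where "h t = min 1 (infdist t C)" for t :: real
  have h: "isCont h t" "norm (h t) \<le> 1" "h t \<ge> 0" for t
    using infdist_nonneg[of t C] unfolding h_def[abs_def]
    by (auto intro!: continuous_min continuous_infdist)
  have hm: "h \<in> borel_measurable N"
    using borel_measurable_continuous_onI[of h] h(1) by (simp add: continuous_at_imp_continuous_on)
  have "(\<lambda>n. \<integral>t. h t \<partial>M n) \<longlonglongrightarrow> (\<integral>t. h t \<partial>N)"
    using assms(1-3) h(1,2) by (rule weak_conv_imp_integral_bdd_continuous_conv)
  moreover have "(\<integral>t. h t \<partial>M n) = 0" for n
  proof (rule integral_eq_zero_AE)
    show "AE t in M n. h t = 0" using assms(6)[of n] by eventually_elim (simp add: h_def)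
  qed
  ultimately have "(\<integral>t. h t \<partial>N) = 0" by (simp add: LIMSEQ_const_iff)
  moreover have "integrable N h" using h hm by (intro N.integrable_const_bound[where B=1]) auto
  ultimately have "AE t in N. h t = 0" using h by (simp add: integral_nonneg_eq_0_iff_AE)
  then show ?thesis
  proof eventually_elim
    fix t assume "h t = 0"
    then have "infdist t C = 0" by (simp add: h_def min_def split: if_splits)
    then show "t \<in> C" using assms(4,5) in_closed_iff_infdist_zero by blast
  qed
qed

lemma tight_of_bounded_support:
  assumes "\<And>n. real_distribution (M n)" "\<And>n. AE t in M n. t \<in> {a..b}"
  shows "tight M"
  unfolding tight_def
proof (intro conjI allI impI)
  fix e :: real assume "e > 0"
  \<comment> \<open>Shifting a down accounts for the open left end; the bounds 0 and 1 make the
    interval nondegenerate without comparing a and b.\<close>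
  have "measure (M n) {min (a - 1) 0<..max b 1} = 1" for n
  proof -
    interpret real_distribution "M n" by (rule assms)
    have "AE t in M n. t \<in> {min (a - 1) 0<..max b 1}" using assms(2)[of n] by eventually_elim auto
    then show ?thesis by (subst prob_eq_1) auto
  qed
  then show "\<exists>c d. c < d \<and> (\<forall>n. 1 - e < measure (M n) {c<..d})"
    using \<open>e > 0\<close> by (intro exI[of _ "min (a - 1) 0"] exI[of _ "max b 1"]) auto
qed (rule assms)

definition converges_weakly :: "(nat \<Rightarrow> 'a::topological_space measure) \<Rightarrow> 'a measure \<Rightarrow> bool" where
  "converges_weakly Q R \<longleftrightarrow>
     (\<forall>h :: 'a \<Rightarrow> real. continuous_on UNIV h \<longrightarrow> (\<lambda>n. \<integral>x. h x \<partial>Q n) \<longlonglongrightarrow> (\<integral>x. h x \<partial>R))"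

text \<open>The measures are pushed to the line by the code s, where bounded support gives tightness
  and a weakly convergent subsequence; the limit is pulled back by the decoding. Since s need not be
  continuous, weak convergence is not transported along s: a continuous h on the space becomes
  \<open>h \<circ> \<phi>\<close> on the closed set of codes, and Tietze's theorem extends it to a
  bounded continuous function H on the line with \<open>H (s x) = h x\<close>.\<close>

theorem prob_seq_compact:
  fixes Q :: "nat \<Rightarrow> 'a::metric_space measure"
  assumes comp: "compact (UNIV :: 'a set)" and Q: "\<And>n. prob_space (Q n)" "\<And>n. sets (Q n) = sets borel"
  obtains r R where "strict_mono (r :: nat \<Rightarrow> nat)" "prob_space R" "sets R = sets (borel :: 'a measure)"
    "converges_weakly (\<lambda>n. Q (r n)) R"
proof -
  obtain s :: "'a \<Rightarrow> real" where s: "s \<in> borel_measurable borel" "\<And>x. 0 \<le> s x" "\<And>x. s x \<le> 3 / 2"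
    "\<And>e. e > 0 \<Longrightarrow> \<exists>d>0. \<forall>x y. \<bar>s x - s y\<bar> < d \<longrightarrow> dist x y < e"
    using compact_coding_exists[OF comp] by blast
  obtain \<phi> :: "real \<Rightarrow> 'a" where \<phi>: "continuous_on (closure (range s)) \<phi>" "\<And>x. \<phi> (s x) = x"
    using decoding_exists[OF comp s(4)] by blast
  let ?C = "closure (range s)"
  have sC: "s x \<in> ?C" for x using closure_subset[of "range s"] by blast
  have sm: "s \<in> borel_measurable (Q n)" for n using s(1) measurable_cong_sets[OF Q(2) refl] by blast
  define M where "M n = distr (Q n) borel s" for n
  have M: "real_distribution (M n)" for n
    unfolding M_def using Q(1) sm by (intro prob_space.real_distribution_distr)
  have MC: "AE t in M n. t \<in> ?C" for n
    unfolding M_def using sm sC by (subst AE_distr_iff) auto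
  have "AE t in M n. t \<in> {0..3/2}" for n
    unfolding M_def using sm s by (subst AE_distr_iff) auto
  then have "tight M" using M by (rule tight_of_bounded_support[rotated])
  from tight_imp_convergent_subsubsequence[OF this strict_mono_id]
  obtain r N where r: "strict_mono (r :: nat \<Rightarrow> nat)" and N: "real_distribution N"
    and w: "weak_conv_m (\<lambda>n. M (r n)) N" by (auto simp: o_def)
  have NC: "AE t in N. t \<in> ?C"
    using weak_limit_closed_support[OF M N w, of ?C] MC by auto
  interpret N: real_distribution N by fact
  obtain x0 :: 'a where True by blast
  \<comment> \<open>The arbitrary value \<open>x0\<close> is taken only on a null set, as N is
    carried by the closed set \<open>?C\<close>.\<close>
  define \<psi> where "\<psi> t = (if t \<in> ?C then \<phi> t else x0)" for t
  have \<psi>m: "\<psi> \<in> measurable N borel"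
  proof -
    have "\<psi> \<in> measurable borel borel"
      unfolding \<psi>_def[abs_def] by (rule borel_measurable_continuous_on_if) (use \<phi> in auto)
    then show ?thesis by simp
  qed
  show thesis
  proof (rule that[OF r, of "distr N borel \<psi>"])
    show "prob_space (distr N borel \<psi>)" using \<psi>m by (rule N.prob_space_distr)
    show "converges_weakly (\<lambda>n. Q (r n)) (distr N borel \<psi>)"
      unfolding converges_weakly_def
    proof (intro allI impI)
      fix h :: "'a \<Rightarrow> real" assume h: "continuous_on UNIV h"
      obtain B0 where "\<And>x. \<bar>h x\<bar> \<le> B0"
        using compact_imp_bounded[OF compact_continuous_image[OF h comp]] by (auto simp: bounded_iff)
      then obtain B where B: "\<And>x. \<bar>h x\<bar> \<le> B" "0 \<le> B" by (meson abs_ge_zero order_trans)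
      have "continuous_on ?C (h \<circ> \<phi>)"
        using \<phi>(1) h by (intro continuous_on_compose) (auto intro: continuous_on_subset)
      then obtain H where H: "continuous_on UNIV H" "\<And>t. t \<in> ?C \<Longrightarrow> H t = h (\<phi> t)" "\<And>t. norm (H t) \<le> B"
        using Tietze[of ?C "h \<circ> \<phi>" UNIV B] B by (auto simp: o_def)
      have "(\<lambda>n. \<integral>t. H t \<partial>M (r n)) \<longlonglongrightarrow> (\<integral>t. H t \<partial>N)"
      proof (rule weak_conv_imp_integral_bdd_continuous_conv[OF M N w])
        show "isCont H t" for t using H(1) continuous_on_eq_continuous_at open_UNIV by blast
      qed (rule H)
      moreover have "(\<integral>t. H t \<partial>M (r n)) = (\<integral>x. h x \<partial>Q (r n))" for n
        unfolding M_def using borel_measurable_continuous_onI[OF H(1)] sm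
        by (simp add: integral_distr H(2) sC \<phi>(2))
      moreover have "(\<integral>t. H t \<partial>N) = (\<integral>x. h x \<partial>distr N borel \<psi>)"
      proof -
        have "(\<integral>x. h x \<partial>distr N borel \<psi>) = (\<integral>t. h (\<psi> t) \<partial>N)"
          using \<psi>m borel_measurable_continuous_onI[OF h] by (intro integral_distr) auto
        also have "\<dots> = (\<integral>t. H t \<partial>N)"
        proof (rule integral_cong_AE)
          show "(\<lambda>t. h (\<psi> t)) \<in> borel_measurable N"
            using \<psi>m borel_measurable_continuous_onI[OF h] by (rule measurable_compose)
          show "H \<in> borel_measurable N" using borel_measurable_continuous_onI[OF H(1)] by simp
          show "AE t in N. h (\<psi> t) = H t" using NC by eventually_elim (simp add: \<psi>_def H(2))
        qed
        finally show ?thesis by simp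
      qed
      ultimately show "(\<lambda>n. \<integral>x. h x \<partial>Q (r n)) \<longlonglongrightarrow> (\<integral>x. h x \<partial>distr N borel \<psi>)" by simp
    qed
  qed simp
qed

section \<open>Invariant measures\<close>

text \<open>Unlike ergodicity, this condition is convex and survives weak limits, so extremal
  arguments can be run on it.\<close>

definition invariant_prob :: "('a::topological_space \<Rightarrow> 'a) \<Rightarrow> 'a measure \<Rightarrow> bool" where
  "invariant_prob T Q \<longleftrightarrow> prob_space Q \<and> sets Q = sets borel \<and> distr Q borel T = Q"

lemma measurable_borel_iff:
  "sets Q = sets borel \<Longrightarrow> f \<in> measurable Q N \<longleftrightarrow> f \<in> measurable borel N"
  using measurable_cong_sets[of Q borel N N] by simp

lemma integrable_continuous_compact:
  fixes h :: "'a::metric_space \<Rightarrow> 'b::{banach, second_countable_topology}"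
  assumes "compact (UNIV :: 'a set)" "finite_measure Q" "sets Q = sets borel" "continuous_on UNIV h"
  shows "integrable Q h"
proof -
  interpret finite_measure Q by fact
  obtain B where B: "\<And>x. norm (h x) \<le> B"
    using compact_imp_bounded[OF compact_continuous_image[OF assms(4,1)]] by (auto simp: bounded_iff)
  then show ?thesis
    using borel_measurable_continuous_onI[OF assms(4)]
    by (intro integrable_const_bound[where B=B]) (auto simp: measurable_borel_iff[OF assms(3)])
qed

lemma invariant_prob_integral:
  fixes h :: "'a::topological_space \<Rightarrow> 'b::{banach, second_countable_topology}"
  assumes "invariant_prob T Q" "T \<in> borel_measurable borel" "h \<in> borel_measurable borel"
  shows "(\<integral>x. h (T x) \<partial>Q) = (\<integral>x. h x \<partial>Q)"
proof -
  have "(\<integral>x. h x \<partial>distr Q borel T) = (\<integral>x. h (T x) \<partial>Q)"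
    using assms measurable_borel_iff[of Q T borel] by (intro integral_distr) (auto simp: invariant_prob_def)
  then show ?thesis using assms(1) by (simp add: invariant_prob_def)
qed

lemma invariant_prob_of_integrals:
  fixes T :: "'a::metric_space \<Rightarrow> 'a"
  assumes comp: "compact (UNIV :: 'a set)" and T: "continuous_on UNIV T"
    and Q: "prob_space Q" "sets Q = sets borel"
    and "\<And>h :: 'a \<Rightarrow> real. continuous_on UNIV h \<Longrightarrow> (\<integral>x. h (T x) \<partial>Q) = (\<integral>x. h x \<partial>Q)"
  shows "invariant_prob T Q"
proof -
  obtain g :: "nat \<Rightarrow> 'a \<Rightarrow> real" where "determining_sequence g"
    using determining_sequence_exists[OF comp] by blast
  then have g: "\<And>i. continuous_on UNIV (g i)"
    and det: "\<And>M N. prob_space M \<Longrightarrow> prob_space N \<Longrightarrow> sets M = sets borel \<Longrightarrow> sets N = sets borel \<Longrightarrow>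
       (\<And>i. (\<integral>x. g i x \<partial>M) = (\<integral>x. g i x \<partial>N)) \<Longrightarrow> M = N"
    unfolding determining_sequence_def by simp_all
  have Tm: "T \<in> measurable Q borel"
    using borel_measurable_continuous_onI[OF T] by (simp add: measurable_borel_iff[OF Q(2)])
  have "distr Q borel T = Q"
  proof (rule det)
    show "prob_space (distr Q borel T)" using Q(1) Tm by (rule prob_space.prob_space_distr)
    show "(\<integral>x. g i x \<partial>distr Q borel T) = (\<integral>x. g i x \<partial>Q)" for i
      using assms(5)[OF g] Tm borel_measurable_continuous_onI[OF g[of i]] by (simp add: integral_distr)
  qed (use Q in auto)
  then show ?thesis using Q by (simp add: invariant_prob_def)
qed

text \<open>Since h composed with T is again a continuous test function, the asymptotic identity
  passes to the weak limit. It is applied to a maximising sequence of invariant measures, where the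
  difference is 0, and to empirical measures of an orbit, where it only tends to 0.\<close>

lemma invariant_prob_seq_compact:
  fixes T :: "'a::metric_space \<Rightarrow> 'a"
  assumes comp: "compact (UNIV :: 'a set)" and T: "continuous_on UNIV T"
    and Q: "\<And>n. prob_space (Q n)" "\<And>n. sets (Q n) = sets borel"
    and asym: "\<And>h :: 'a \<Rightarrow> real. continuous_on UNIV h \<Longrightarrow>
      (\<lambda>n. (\<integral>x. h (T x) \<partial>Q n) - (\<integral>x. h x \<partial>Q n)) \<longlonglongrightarrow> 0"
  obtains r R where "strict_mono (r :: nat \<Rightarrow> nat)" "invariant_prob T R"
    "converges_weakly (\<lambda>n. Q (r n)) R"
proof -
  obtain r R where r: "strict_mono (r :: nat \<Rightarrow> nat)" and R: "prob_space R" "sets R = sets borel"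
    and conv: "converges_weakly (\<lambda>n. Q (r n)) R"
    using prob_seq_compact[of Q] comp Q by blast
  then have lim: "\<And>h :: 'a \<Rightarrow> real. continuous_on UNIV h \<Longrightarrow> (\<lambda>n. \<integral>x. h x \<partial>Q (r n)) \<longlonglongrightarrow> (\<integral>x. h x \<partial>R)"
    unfolding converges_weakly_def by simp
  have "(\<integral>x. h (T x) \<partial>R) = (\<integral>x. h x \<partial>R)" if h: "continuous_on UNIV h" for h :: "'a \<Rightarrow> real"
  proof -
    have "continuous_on UNIV (\<lambda>x. h (T x))" using continuous_on_compose2[OF h T] by simp
    then have "(\<lambda>n. (\<integral>x. h (T x) \<partial>Q (r n)) - (\<integral>x. h x \<partial>Q (r n))) \<longlonglongrightarrow> (\<integral>x. h (T x) \<partial>R) - (\<integral>x. h x \<partial>R)"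
      using h by (intro tendsto_diff lim)
    moreover have "(\<lambda>n. (\<integral>x. h (T x) \<partial>Q (r n)) - (\<integral>x. h x \<partial>Q (r n))) \<longlonglongrightarrow> 0"
      using LIMSEQ_subseq_LIMSEQ[OF asym[OF h] r] by (simp add: o_def)
    ultimately show ?thesis using LIMSEQ_unique by fastforce
  qed
  then have "invariant_prob T R" using comp T R by (intro invariant_prob_of_integrals)
  with r conv show thesis using that by blast
qed

section \<open>From a unique ergodic measure to a unique invariant measure\<close>

lemma invariant_prob_uniform_measure:
  fixes T :: "'a::topological_space \<Rightarrow> 'a"
  assumes Q: "invariant_prob T Q" and T: "T \<in> borel_measurable borel"
    and A: "A \<in> sets borel" "T -` A = A" "measure Q A \<noteq> 0"
  shows "invariant_prob T (uniform_measure Q A)"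
proof -
  interpret prob_space Q using Q by (simp add: invariant_prob_def)
  have sQ: "sets Q = sets borel" and dQ: "distr Q borel T = Q" using Q by (auto simp: invariant_prob_def)
  have TQ: "T \<in> measurable Q borel" using T by (simp add: measurable_borel_iff[OF sQ])
  have spQ: "space Q = UNIV" using sets_eq_imp_space_eq[OF sQ] by simp
  have A0: "emeasure Q A \<noteq> 0" using A(3) by (simp add: emeasure_eq_measure)
  have TU: "T \<in> measurable (uniform_measure Q A) borel"
    using T by (subst measurable_borel_iff) (simp_all add: sQ)
  have "distr (uniform_measure Q A) borel T = uniform_measure Q A"
  proof (rule measure_eqI)
    fix B assume "B \<in> sets (distr (uniform_measure Q A) borel T)"
    then have B: "B \<in> sets borel" by simp
    have TB: "T -` B \<in> sets borel" using measurable_sets[OF T B] by simp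
    have "emeasure (distr (uniform_measure Q A) borel T) B = emeasure (uniform_measure Q A) (T -` B)"
      using B by (simp add: emeasure_distr[OF TU] spQ)
    also have "\<dots> = emeasure Q (A \<inter> T -` B) / emeasure Q A"
      using A(1) TB by (simp add: sQ)
    also have "A \<inter> T -` B = T -` (A \<inter> B)" using A(2) by auto
    also have "emeasure Q (T -` (A \<inter> B)) = emeasure (distr Q borel T) (A \<inter> B)"
      using A(1) B by (simp add: emeasure_distr[OF TQ] spQ)
    also have "\<dots> = emeasure Q (A \<inter> B)" by (simp only: dQ)
    also have "emeasure Q (A \<inter> B) / emeasure Q A = emeasure (uniform_measure Q A) B"
      using A(1) B by (simp add: sQ)
    finally show "emeasure (distr (uniform_measure Q A) borel T) B = emeasure (uniform_measure Q A) B" .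
  qed (simp add: sQ)
  moreover have "prob_space (uniform_measure Q A)"
    using A0 by (intro prob_space_uniform_measure) auto
  ultimately show ?thesis by (simp add: invariant_prob_def sQ)
qed

lemma (in finite_measure) integral_uniform_measure:
  fixes h :: "'a \<Rightarrow> real"
  assumes A: "A \<in> sets M" "measure M A \<noteq> 0" and h: "h \<in> borel_measurable M"
  shows "measure M A * (\<integral>x. h x \<partial>uniform_measure M A) = (\<integral>x. indicator A x * h x \<partial>M)"
proof -
  have "uniform_measure M A = density M (\<lambda>x. ennreal (indicator A x / measure M A))"
    unfolding uniform_measure_def
    using A(2) by (intro arg_cong[where f="density M"] ext)
      (auto simp: emeasure_eq_measure indicator_def divide_ennreal[symmetric] zero_less_measure_iff)
  then have "(\<integral>x. h x \<partial>uniform_measure M A) = (\<integral>x. (indicator A x / measure M A) *\<^sub>R h x \<partial>M)"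
    using A h by (simp add: integral_density)
  also have "\<dots> = (\<integral>x. indicator A x * h x \<partial>M) / measure M A"
    by simp
  finally show ?thesis using A(2) by simp
qed

text \<open>The functional maximised here is a small strictly convex perturbation of the integral of h.
  Its maximiser over the invariant measures is therefore an extreme point, hence ergodic, hence
  equal to P; this replaces the ergodic decomposition.\<close>

theorem uniquely_ergodic_integral_le:
  fixes T :: "'a::metric_space \<Rightarrow> 'a" and h :: "'a \<Rightarrow> real"
  assumes ue: "uniquely_ergodic T P" and Q0: "invariant_prob T Q0" and h: "continuous_on UNIV h"
  shows "(\<integral>x. h x \<partial>Q0) \<le> (\<integral>x. h x \<partial>P)"
proof (rule field_le_epsilon)
  fix \<epsilon> :: real assume "\<epsilon> > 0"
  \<comment> \<open>As \<open>\<Phi>\<close> takes values between 0 and 2, the perturbation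
    \<open>e * \<Phi>\<close> costs at most \<open>\<epsilon>\<close>.\<close>
  define e where "e = \<epsilon> / 2"
  have e: "e > 0" using \<open>\<epsilon> > 0\<close> by (simp add: e_def)
  have comp: "compact (UNIV :: 'a set)" and T: "continuous_on UNIV T"
    using ue by (auto simp: uniquely_ergodic_def homeomorphism_def)
  have Tm: "T \<in> borel_measurable borel" using T by (rule borel_measurable_continuous_onI)
  obtain g :: "nat \<Rightarrow> 'a \<Rightarrow> real" where "determining_sequence g"
    using determining_sequence_exists[OF comp] by blast
  then have g: "\<And>i. continuous_on UNIV (g i)" and g01: "\<And>i x. 0 \<le> g i x" "\<And>i x. g i x \<le> 1"
    and det: "\<And>M N. prob_space M \<Longrightarrow> prob_space N \<Longrightarrow> sets M = sets borel \<Longrightarrow> sets N = sets borel \<Longrightarrow>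
       (\<And>i. (\<integral>x. g i x \<partial>M) = (\<integral>x. g i x \<partial>N)) \<Longrightarrow> M = N"
    unfolding determining_sequence_def by simp_all
  obtain B where B: "\<And>x. \<bar>h x\<bar> \<le> B"
    using compact_imp_bounded[OF compact_continuous_image[OF h comp]] by (auto simp: bounded_iff)
  define I where "I Q i = (\<integral>x. g i x \<partial>Q)" for Q i
  \<comment> \<open>Squares make the functional convex, strictly so because the g i separate
    measures; the geometric weights make it continuous along weakly convergent sequences, by
    Tannery's theorem.\<close>
  define \<Phi> where "\<Phi> Q = (\<Sum>i. (1/2)^i * (I Q i)\<^sup>2)" for Q
  define \<Psi> where "\<Psi> Q = (\<integral>x. h x \<partial>Q) + e * \<Phi> Q" for Q
  have int: "integrable Q k" if "invariant_prob T Q" "continuous_on UNIV k" for Q and k :: "'a \<Rightarrow> real"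
    using that comp by (intro integrable_continuous_compact prob_space.finite_measure)
      (auto simp: invariant_prob_def)
  have I01: "0 \<le> I Q i" "I Q i \<le> 1" if "invariant_prob T Q" for Q i
  proof -
    interpret prob_space Q using that by (simp add: invariant_prob_def)
    show "0 \<le> I Q i" unfolding I_def using g01 by (intro integral_nonneg_AE) auto
    show "I Q i \<le> 1" unfolding I_def using g01 int[OF that g] by (intro integral_le_const) auto
  qed
  have I2: "0 \<le> (I Q i)\<^sup>2" "(I Q i)\<^sup>2 \<le> 1" if "invariant_prob T Q" for Q i
    using I01[OF that, of i] by (auto simp: power_le_one)
  have geo: "summable (\<lambda>i. (1/2)^i :: real)" "(\<Sum>i. (1/2)^i :: real) = 2"
    by (auto simp: summable_geometric suminf_geometric)
  have sum\<Phi>: "summable (\<lambda>i. (1/2)^i * (I Q i)\<^sup>2)" if "invariant_prob T Q" for Q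
    using geo(1) I2[OF that]
    by (intro summable_comparison_test'[OF geo(1)]) (auto simp: abs_mult mult_left_le)
  have \<Phi>2: "0 \<le> \<Phi> Q" "\<Phi> Q \<le> 2" if "invariant_prob T Q" for Q
  proof -
    show "0 \<le> \<Phi> Q" unfolding \<Phi>_def using sum\<Phi>[OF that] by (intro suminf_nonneg) auto
    have "\<Phi> Q \<le> (\<Sum>i. (1/2)^i)" unfolding \<Phi>_def
      using sum\<Phi>[OF that] geo(1) I2[OF that] by (intro suminf_le) (auto simp: mult_left_le)
    then show "\<Phi> Q \<le> 2" using geo(2) by simp
  qed
  have hB: "(\<integral>x. h x \<partial>Q) \<le> B" if "invariant_prob T Q" for Q
  proof -
    interpret prob_space Q using that by (simp add: invariant_prob_def)
    show ?thesis using B int[OF that h] by (intro integral_le_const) (auto intro: order_trans[OF abs_ge_self])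
  qed
  let ?J = "{Q. invariant_prob T Q}"
  have bdd: "bdd_above (\<Psi> ` ?J)"
  proof (rule bdd_aboveI2)
    fix Q assume "Q \<in> ?J"
    then have "(\<integral>x. h x \<partial>Q) \<le> B" "e * \<Phi> Q \<le> e * 2"
      using hB \<Phi>2 e by (auto intro: mult_left_mono)
    then show "\<Psi> Q \<le> B + e * 2" unfolding \<Psi>_def by (rule add_mono)
  qed
  define S where "S = (SUP Q\<in>?J. \<Psi> Q)"
  have le_S: "\<Psi> Q \<le> S" if "invariant_prob T Q" for Q
    unfolding S_def using that bdd by (intro cSUP_upper) auto
  have "\<exists>Q. invariant_prob T Q \<and> S - 1 / Suc n < \<Psi> Q" for n
  proof -
    have "S - 1 / Suc n < S" by simp
    then show ?thesis using less_cSUP_iff[OF _ bdd, of "S - 1 / Suc n"] Q0 unfolding S_def by auto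
  qed
  then obtain Q where Q: "\<And>n. invariant_prob T (Q n)" "\<And>n. S - 1 / Suc n < \<Psi> (Q n)" by metis
  obtain r R where r: "strict_mono (r :: nat \<Rightarrow> nat)" and R: "invariant_prob T R"
    and conv: "converges_weakly (\<lambda>n. Q (r n)) R"
  proof (rule invariant_prob_seq_compact[OF comp T, of Q])
    show "prob_space (Q n)" "sets (Q n) = sets borel" for n using Q(1) by (auto simp: invariant_prob_def)
    show "(\<lambda>n. (\<integral>x. k (T x) \<partial>Q n) - (\<integral>x. k x \<partial>Q n)) \<longlonglongrightarrow> 0" if "continuous_on UNIV k" for k :: "'a \<Rightarrow> real"
      using invariant_prob_integral[OF Q(1) Tm borel_measurable_continuous_onI[OF that]] by simp
  qed
  have lim: "\<And>h :: 'a \<Rightarrow> real. continuous_on UNIV h \<Longrightarrow> (\<lambda>n. \<integral>x. h x \<partial>Q (r n)) \<longlonglongrightarrow> (\<integral>x. h x \<partial>R)"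
    using conv unfolding converges_weakly_def by simp
  have "(\<lambda>n. \<Phi> (Q (r n))) \<longlonglongrightarrow> \<Phi> R"
  proof -
    have tl: "(\<lambda>n. (1/2)^i * (I (Q (r n)) i)\<^sup>2) \<longlonglongrightarrow> (1/2)^i * (I R i)\<^sup>2" for i
      unfolding I_def by (intro tendsto_intros lim g)
    have "\<forall>\<^sub>F (i, n) in at_top \<times>\<^sub>F sequentially. norm ((1/2)^i * (I (Q (r n)) i)\<^sup>2) \<le> (1/2)^i"
      using I2[OF Q(1)] by (intro always_eventually) (auto simp: abs_mult mult_left_le)
    from tannerys_theorem[OF tl this geo(1) sequentially_bot] show ?thesis
      unfolding \<Phi>_def by blast
  qed
  then have "(\<lambda>n. \<Psi> (Q (r n))) \<longlonglongrightarrow> \<Psi> R"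
    unfolding \<Psi>_def by (intro tendsto_intros lim h)
  moreover have \<Psi>Q: "(\<lambda>n. \<Psi> (Q n)) \<longlonglongrightarrow> S"
  proof (rule tendsto_sandwich)
    show "\<forall>\<^sub>F n in sequentially. S - 1 / Suc n \<le> \<Psi> (Q n)" using Q(2) by (simp add: less_imp_le)
    show "\<forall>\<^sub>F n in sequentially. \<Psi> (Q n) \<le> S" using le_S Q(1) by simp
    have "(\<lambda>n. S - 1 / Suc n) \<longlonglongrightarrow> S - 0" by (intro tendsto_intros LIMSEQ_Suc[OF lim_1_over_n])
    then show "(\<lambda>n. S - 1 / Suc n) \<longlonglongrightarrow> S" by simp
  qed simp
  ultimately have \<Psi>R: "\<Psi> R = S" 
    using LIMSEQ_unique LIMSEQ_subseq_LIMSEQ[OF \<Psi>Q r, unfolded o_def] by blast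
  interpret R: prob_space R using R by (simp add: invariant_prob_def)
  have sR: "sets R = sets borel" and dR: "distr R borel T = R" using R by (auto simp: invariant_prob_def)
  have spR: "space R = UNIV" using sets_eq_imp_space_eq[OF sR] by simp
  have "ergodic_measure T R"
    unfolding ergodic_measure_def
  proof (intro conjI ballI impI)
    show "T \<in> measurable R R" using Tm measurable_cong_sets[OF sR sR] by simp
    have "distr R R T = distr R borel T" by (rule distr_cong) (auto simp: sR)
    then show "distr R R T = R" using dR by simp
    fix A assume A: "A \<in> sets R" "T -` A = A"
    show "measure R A = 0 \<or> measure R A = 1"
    proof (rule ccontr)
      assume H: "\<not> (measure R A = 0 \<or> measure R A = 1)"
      define a where "a = measure R A"
      have a: "0 < a" "a < 1" using H R.prob_le_1[of A] unfolding a_def by (auto simp: zero_less_measure_iff less_le)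
      have aC: "measure R (- A) = 1 - a" using R.prob_compl[OF A(1)] by (simp add: a_def spR Compl_eq_Diff_UNIV)
      have CA: "- A \<in> sets R" using A(1) sets.compl_sets[of A R] by (simp add: spR Compl_eq_Diff_UNIV)
      \<comment> \<open>Conditioning on the invariant set A and on its complement writes the
        maximiser as a proper convex combination of two invariant measures.\<close>
      define Q1 where "Q1 = uniform_measure R A"
      define Q2 where "Q2 = uniform_measure R (- A)"
      have Q1: "invariant_prob T Q1" unfolding Q1_def
        using R Tm A a by (intro invariant_prob_uniform_measure) (auto simp: a_def sR)
      have Q2: "invariant_prob T Q2" unfolding Q2_def
        using R Tm A CA a aC by (intro invariant_prob_uniform_measure) (auto simp: sR)
      have dec: "(\<integral>x. k x \<partial>R) = a * (\<integral>x. k x \<partial>Q1) + (1 - a) * (\<integral>x. k x \<partial>Q2)"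
        if k: "continuous_on UNIV k" for k :: "'a \<Rightarrow> real"
      proof -
        have kR: "integrable R k" by (rule int[OF R k])
        have "(\<integral>x. k x \<partial>R) = (\<integral>x. indicator A x * k x + indicator (- A) x * k x \<partial>R)"
          by (intro Bochner_Integration.integral_cong) (auto simp: indicator_def)
        also have "\<dots> = (\<integral>x. indicator A x * k x \<partial>R) + (\<integral>x. indicator (- A) x * k x \<partial>R)"
          using A(1) CA kR by (intro Bochner_Integration.integral_add integrable_real_mult_indicator)
            (auto intro!: integrable_mult_indicator[where 'b=real, simplified])
        also have "\<dots> = a * (\<integral>x. k x \<partial>Q1) + (1 - a) * (\<integral>x. k x \<partial>Q2)"
          using R.integral_uniform_measure[OF A(1), of k] R.integral_uniform_measure[OF CA, of k] a kR
          by (simp add: Q1_def Q2_def a_def[symmetric] aC)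
        finally show ?thesis .
      qed
      define D where "D = (\<Sum>i. (1/2)^i * (I Q1 i - I Q2 i)\<^sup>2)"
      have sqd: "(I Q1 i - I Q2 i)\<^sup>2 \<le> 1" for i
        using I01[OF Q1, of i] I01[OF Q2, of i] by (intro power2_le_iff_abs_le[THEN iffD2, of 1, simplified]) (auto simp: abs_le_iff)
      have sumD: "summable (\<lambda>i. (1/2)^i * (I Q1 i - I Q2 i)\<^sup>2)"
        using sqd by (intro summable_comparison_test'[OF geo(1)]) (auto simp: abs_mult mult_left_le)
      \<comment> \<open>The convexity defect of the square, termwise: for s the combination of p and
        q with weights a and 1 - a, the square of s falls short of the combined squares by exactly
        a(1 - a) times the square of p - q.\<close>
      have "\<Phi> R = (\<Sum>i. a * ((1/2)^i * (I Q1 i)\<^sup>2) + (1 - a) * ((1/2)^i * (I Q2 i)\<^sup>2)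
          - a * (1 - a) * ((1/2)^i * (I Q1 i - I Q2 i)\<^sup>2))"
        unfolding \<Phi>_def
      proof (rule suminf_cong)
        fix i
        have IR: "I R i = a * I Q1 i + (1 - a) * I Q2 i" unfolding I_def by (rule dec[OF g])
        show "(1/2)^i * (I R i)\<^sup>2 = a * ((1/2)^i * (I Q1 i)\<^sup>2) + (1 - a) * ((1/2)^i * (I Q2 i)\<^sup>2)
          - a * (1 - a) * ((1/2)^i * (I Q1 i - I Q2 i)\<^sup>2)"
          unfolding IR by (simp add: power2_eq_square algebra_simps)
      qed
      also have "\<dots> = a * \<Phi> Q1 + (1 - a) * \<Phi> Q2 - a * (1 - a) * D"
        unfolding \<Phi>_def D_def using sum\<Phi>[OF Q1] sum\<Phi>[OF Q2] sumD
        by (intro sums_unique[symmetric] sums_diff sums_add sums_mult summable_sums)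
      finally have \<Phi>R: "\<Phi> R = a * \<Phi> Q1 + (1 - a) * \<Phi> Q2 - a * (1 - a) * D" .
      \<comment> \<open>Both components have value at most S while R attains S, so the defect D
        vanishes and Q1 = Q2. This is absurd, since they give A the masses 1 and 0.\<close>
      have "\<Psi> R = a * \<Psi> Q1 + (1 - a) * \<Psi> Q2 - e * (a * (1 - a) * D)"
        unfolding \<Psi>_def dec[OF h] \<Phi>R by (simp add: algebra_simps)
      moreover have "a * \<Psi> Q1 \<le> a * S" "(1 - a) * \<Psi> Q2 \<le> (1 - a) * S"
        using a le_S[OF Q1] le_S[OF Q2] by auto
      ultimately have "e * (a * (1 - a) * D) \<le> 0" using \<Psi>R by (simp add: algebra_simps)
      then have "D \<le> 0" using e a by (simp add: mult_le_0_iff)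
      moreover have "D \<ge> 0" unfolding D_def using sumD by (intro suminf_nonneg) auto
      ultimately have "D = 0" by simp
      then have "I Q1 i = I Q2 i" for i
        using sumD unfolding D_def by (subst (asm) suminf_eq_zero_iff) auto
      then have "Q1 = Q2" using Q1 Q2 by (intro det) (auto simp: invariant_prob_def I_def)
      moreover have "measure Q1 A = 1" unfolding Q1_def using A a
        by (subst measure_uniform_measure) (auto simp: R.emeasure_eq_measure a_def)
      moreover have "measure Q2 A = 0" unfolding Q2_def using A CA a aC
        by (subst measure_uniform_measure) (auto simp: R.emeasure_eq_measure)
      ultimately show False by simp
    qed
  qed (use sR in \<open>auto intro: R.prob_space_axioms\<close>)
  then have "R = P" using ue by (simp add: uniquely_ergodic_def)
  have "(\<integral>x. h x \<partial>Q0) \<le> \<Psi> Q0" unfolding \<Psi>_def using \<Phi>2[OF Q0] e by simp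
  also have "\<dots> \<le> \<Psi> P" using le_S[OF Q0] \<Psi>R \<open>R = P\<close> by simp
  also have "\<dots> \<le> (\<integral>x. h x \<partial>P) + \<epsilon>"
    unfolding \<Psi>_def e_def using \<Phi>2[OF R] \<open>\<epsilon> > 0\<close> \<open>R = P\<close> by simp
  finally show "(\<integral>x. h x \<partial>Q0) \<le> (\<integral>x. h x \<partial>P) + \<epsilon>" .
qed

section \<open>Herglotz' theorem\<close>

text \<open>Normalised, and kept on the Borel sets of the whole line instead of
  \<open>circle_borel\<close>, so that weak convergence of distributions on the line applies to
  densities with respect to it.\<close>

definition circle_uniform :: "real measure" where
  "circle_uniform = uniform_measure lborel {0..<2 * pi}"

lemma sets_circle_uniform [simp, measurable_cong]: "sets circle_uniform = sets borel"
  by (simp add: circle_uniform_def)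

lemma space_circle_uniform [simp]: "space circle_uniform = UNIV"
  by (simp add: circle_uniform_def)

lemma prob_space_circle_uniform: "prob_space circle_uniform"
  unfolding circle_uniform_def by (rule prob_space_uniform_measure) auto

lemma circle_uniform_density:
  "circle_uniform = density lborel (\<lambda>t. ennreal (indicator {0..<2 * pi} t / (2 * pi)))"
  unfolding circle_uniform_def uniform_measure_def
  by (intro arg_cong[where f="density lborel"] ext)
    (auto simp: indicator_def divide_ennreal[symmetric])

lemma borel_measurable_cis [measurable]: "cis \<in> borel_measurable borel"
  by (intro borel_measurable_continuous_onI continuous_intros)

lemma integral_circle_uniform_cis:
  "(\<integral>t. cis (of_int k * t) \<partial>circle_uniform) = of_bool (k = 0)"
proof (cases "k = 0")
  case True
  interpret prob_space circle_uniform by (rule prob_space_circle_uniform)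
  show ?thesis using True prob_space by simp
next
  case False
  have "(\<integral>t. cis (of_int k * t) \<partial>circle_uniform) =
      (\<integral>t. (indicator {0..<2 * pi} t / (2 * pi)) *\<^sub>R cis (of_int k * t) \<partial>lborel)"
    unfolding circle_uniform_density
    by (rule integral_density) (auto intro!: borel_measurable_continuous_onI continuous_intros)
  \<comment> \<open>The fundamental theorem of calculus is stated for closed intervals; the endpoint
    added is a null set.\<close>
  also have "\<dots> = (\<integral>t. indicator {0..2 * pi} t *\<^sub>R (cis (of_int k * t) / of_real (2 * pi)) \<partial>lborel)"
  proof (rule integral_cong_AE)
    show "AE t in lborel. (indicator {0..<2 * pi} t / (2 * pi)) *\<^sub>R cis (of_int k * t) =
        indicator {0..2 * pi} t *\<^sub>R (cis (of_int k * t) / of_real (2 * pi))"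
      using AE_lborel_singleton[of "2 * pi"]
      by eventually_elim (auto simp: indicator_def scaleR_conv_of_real)
  qed measurable
  also have "\<dots> = cis (of_int k * (2 * pi)) / (\<i> * of_int k * of_real (2 * pi))
      - cis (of_int k * 0) / (\<i> * of_int k * of_real (2 * pi))"
  proof (rule integral_FTC_atLeastAtMost)
    fix t
    have "((\<lambda>t. cis (of_int k * t)) has_vector_derivative of_int k *\<^sub>R (\<i> * cis (of_int k * t)))
        (at t within {0..2 * pi})"
      unfolding has_vector_derivative_def
      by (rule has_derivative_eq_rhs, rule derivative_eq_intros)
        (auto intro!: derivative_eq_intros simp: scaleR_conv_of_real)
    from has_vector_derivative_divide[OF this, of "\<i> * of_int k * of_real (2 * pi)"]
    show "((\<lambda>t. cis (of_int k * t) / (\<i> * of_int k * of_real (2 * pi))) has_vector_derivative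
        cis (of_int k * t) / of_real (2 * pi)) (at t within {0..2 * pi})"
      using False by (simp add: scaleR_conv_of_real)
  qed (auto intro!: continuous_intros)
  also have "cis (of_int k * (2 * pi)) = 1"
    using cis_multiple_2pi[of "of_int k"] by (simp add: mult.commute)
  finally show ?thesis using False by simp
qed

text \<open>These are the Fejer weights; truncated subtraction gives 0 for lags out of range. The
  bijection lists the pairs of a fixed difference by their minimum.\<close>

lemma card_diff_eq: "card {(i, j). i < n \<and> j < n \<and> int i - int j = k} = n - nat \<bar>k\<bar>"
proof -
  have "card {(i, j). i < n \<and> j < n \<and> int i - int j = k} = card {..<n - nat \<bar>k\<bar>}"
  proof (rule bij_betw_same_card[symmetric])
    show "bij_betw (\<lambda>m. (m + nat k, m + nat (- k))) {..<n - nat \<bar>k\<bar>} {(i, j). i < n \<and> j < n \<and> int i - int j = k}"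
      by (rule bij_betw_byWitness[where f'="\<lambda>(i, j). min i j"]) auto
  qed
  then show ?thesis by simp
qed

text \<open>The Fejer mean \<open>F n\<close> of the Fourier series of c is nonnegative: positive
  definiteness is applied to the vector of the \<open>cis (i * t)\<close>. With
  \<open>c 0 = 1\<close> it is a probability density, whose coefficient at k is c k times a factor
  tending to 1. All these measures live on a bounded interval, so a subsequence converges weakly,
  and the limit has the coefficients c k.\<close>

theorem herglotz:
  fixes c :: "int \<Rightarrow> complex"
  assumes pos: "\<And>n z. (\<Sum>i<n. \<Sum>j<n. z i * cnj (z j) * c (int i - int j)) \<in> \<real>\<^sub>\<ge>\<^sub>0"
    and c0: "c 0 = 1"
  obtains \<sigma> where "sets \<sigma> = sets circle_borel" "prob_space \<sigma>"
    "\<And>k::int. (\<integral>t. cis (- (of_int k * t)) \<partial>\<sigma>) = c k"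
proof -
  interpret U: prob_space circle_uniform by (rule prob_space_circle_uniform)
  define F where "F n t = (\<Sum>i<Suc n. \<Sum>j<Suc n. c (int i - int j) * cis (of_int (int i - int j) * t)) / of_nat (Suc n)"
    for n t
  define D where "D n t = Re (F n t)" for n t
  have FD: "F n t = of_real (D n t)" and D0: "0 \<le> D n t" for n t
  proof -
    have "(\<Sum>i<Suc n. \<Sum>j<Suc n. c (int i - int j) * cis (of_int (int i - int j) * t))
        = (\<Sum>i<Suc n. \<Sum>j<Suc n. cis (real i * t) * cnj (cis (real j * t)) * c (int i - int j))"
      by (intro sum.cong refl) (simp add: cis_cnj cis_mult algebra_simps)
    then have "(\<Sum>i<Suc n. \<Sum>j<Suc n. c (int i - int j) * cis (of_int (int i - int j) * t)) \<in> \<real>\<^sub>\<ge>\<^sub>0"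
      using pos by (simp only:)
    then obtain r where r: "r \<ge> 0" "(\<Sum>i<Suc n. \<Sum>j<Suc n. c (int i - int j) * cis (of_int (int i - int j) * t)) = of_real r"
      by (rule nonneg_Reals_cases)
    have "F n t = of_real (r / Suc n)" unfolding F_def r(2) by simp
    then show "F n t = of_real (D n t)" "0 \<le> D n t" using r(1) by (simp_all add: D_def)
  qed
  have contF: "continuous_on UNIV (F n)" for n
    unfolding F_def[abs_def] by (intro continuous_intros) (auto simp del: of_nat_Suc)
  then have contD: "continuous_on UNIV (D n)" for n
    unfolding D_def[abs_def] by (intro continuous_intros)
  have Dm [measurable]: "D n \<in> borel_measurable borel" for n
    using contD by (rule borel_measurable_continuous_onI)
  have cism: "(\<lambda>t. cis (a * t)) \<in> borel_measurable borel" for a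
    by (intro borel_measurable_continuous_onI continuous_intros)
  have icis: "integrable circle_uniform (\<lambda>t. cis (a * t))" for a
    using cism by (intro U.integrable_const_bound[where B=1]) auto
  have coeff: "(\<integral>t. F n t * cis (- (of_int k * t)) \<partial>circle_uniform) =
      c k * of_nat (Suc n - nat \<bar>k\<bar>) / of_nat (Suc n)" for n k
  proof -
    let ?S = "{(i, j). i < Suc n \<and> j < Suc n \<and> int i - int j = k}"
    have "F n t * cis (- (of_int k * t)) =
        (\<Sum>i<Suc n. \<Sum>j<Suc n. (c (int i - int j) / of_nat (Suc n)) * cis (of_int (int i - int j - k) * t))" for t
      unfolding F_def sum_divide_distrib sum_distrib_right
      by (intro sum.cong refl) (simp add: cis_mult algebra_simps del: of_nat_Suc)
    then have "(\<integral>t. F n t * cis (- (of_int k * t)) \<partial>circle_uniform) =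
        (\<Sum>i<Suc n. \<Sum>j<Suc n. (c (int i - int j) / of_nat (Suc n)) * of_bool (int i - int j - k = 0))"
      using icis by (simp add: Bochner_Integration.integral_sum integral_circle_uniform_cis
          del: of_int_diff sum.lessThan_Suc of_nat_Suc)
    also have "\<dots> = (\<Sum>(i,j)\<in>{..<Suc n}\<times>{..<Suc n}. if int i - int j = k then c k / of_nat (Suc n) else 0)"
      by (subst sum.cartesian_product, intro sum.cong) (auto simp del: of_nat_Suc)
    also have "\<dots> = (\<Sum>p\<in>?S. c k / of_nat (Suc n))"
      by (intro sum.mono_neutral_cong_right) (auto split: if_splits)
    also have "\<dots> = c k * of_nat (Suc n - nat \<bar>k\<bar>) / of_nat (Suc n)"
      by (simp add: card_diff_eq del: of_nat_Suc)
    finally show ?thesis .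
  qed
  define M where "M n = density circle_uniform (\<lambda>t. ennreal (D n t))" for n
  have intM: "(\<integral>t. h t \<partial>M n) = (\<integral>t. F n t * h t \<partial>circle_uniform)"
    if "h \<in> borel_measurable borel" for n and h :: "real \<Rightarrow> complex"
    unfolding M_def FD using that D0
    by (subst integral_density) (auto simp: scaleR_conv_of_real)
  have iD: "integrable circle_uniform (D n)" for n
  proof -
    have "integrable circle_uniform (F n)"
      unfolding F_def[abs_def] using icis by (intro integrable_divide Bochner_Integration.integrable_sum integrable_mult_right)
    then show ?thesis unfolding D_def[abs_def] by (rule integrable_Re)
  qed
  have probM: "prob_space (M n)" for n
  proof (rule prob_spaceI)
    have "complex_of_real (\<integral>t. D n t \<partial>circle_uniform) = 1"
      using coeff[of n 0] by (simp add: FD c0 del: of_nat_Suc)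
    then have "(\<integral>t. D n t \<partial>circle_uniform) = 1" by (simp only: of_real_eq_1_iff)
    moreover have "emeasure (M n) (space (M n)) = (\<integral>\<^sup>+t. ennreal (D n t) \<partial>circle_uniform)"
      unfolding M_def by (subst emeasure_density) (auto simp: )
    ultimately show "emeasure (M n) (space (M n)) = 1"
      using nn_integral_eq_integral[OF iD] D0 by simp
  qed
  have M: "real_distribution (M n)" for n
    using probM by (auto simp: real_distribution_def real_distribution_axioms_def M_def)
  have "AE t in circle_uniform. t \<in> {0..2 * pi}"
    unfolding circle_uniform_def by (rule AE_uniform_measureI) auto
  then have supp: "AE t in M n. t \<in> {0..2 * pi}" for n
    unfolding M_def by (subst AE_density) auto
  from tight_imp_convergent_subsubsequence[OF tight_of_bounded_support[of M 0 "2 * pi", OF M supp] strict_mono_id]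
  obtain r N where r: "strict_mono (r :: nat \<Rightarrow> nat)" and N: "real_distribution N"
    and w: "weak_conv_m (\<lambda>n. M (r n)) N" by (auto simp: o_def)
  have NC: "AE t in N. t \<in> {0..2 * pi}"
    using weak_limit_closed_support[OF M N w, of "{0..2 * pi}"] supp by auto
  interpret N: real_distribution N by fact
  have intN: "(\<integral>t. cis (- (of_int k * t)) \<partial>N) = c k" for k :: int
  proof (rule LIMSEQ_unique)
    have "continuous_on UNIV (\<lambda>t. cis (- (of_int k * t)))" by (intro continuous_intros)
    then show "(\<lambda>n. \<integral>t. cis (- (of_int k * t)) \<partial>M (r n)) \<longlonglongrightarrow> (\<integral>t. cis (- (of_int k * t)) \<partial>N)"
      by (intro weak_conv_imp_integral_bdd_continuous_conv[OF M N w, where B=1])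
        (auto simp: continuous_on_eq_continuous_at)
    have "(\<lambda>n. c k * of_nat (Suc n - nat \<bar>k\<bar>) / of_nat (Suc n)) \<longlonglongrightarrow> c k"
    proof (rule Lim_transform_eventually)
      have "(\<lambda>n. c k * (1 - of_nat (nat \<bar>k\<bar>) * (1 / of_nat (Suc n)))) \<longlonglongrightarrow> c k * (1 - of_nat (nat \<bar>k\<bar>) * 0)"
        by (intro tendsto_intros LIMSEQ_Suc[OF lim_1_over_n])
      then show "(\<lambda>n. c k * (1 - of_nat (nat \<bar>k\<bar>) * (1 / of_nat (Suc n)))) \<longlonglongrightarrow> c k" by simp
      show "\<forall>\<^sub>F n in sequentially. c k * (1 - of_nat (nat \<bar>k\<bar>) * (1 / of_nat (Suc n))) =
          c k * of_nat (Suc n - nat \<bar>k\<bar>) / of_nat (Suc n)"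
        using eventually_ge_at_top[of "nat \<bar>k\<bar>"]
        by eventually_elim (simp add: of_nat_diff field_simps del: of_nat_Suc)
    qed
    moreover have "(\<integral>t. cis (- (of_int k * t)) \<partial>M n) = c k * of_nat (Suc n - nat \<bar>k\<bar>) / of_nat (Suc n)" for n
      using intM[OF cism[of "- of_int k"]] coeff[of n k] by simp
    ultimately have "(\<lambda>n. \<integral>t. cis (- (of_int k * t)) \<partial>M n) \<longlonglongrightarrow> c k" by (simp del: of_nat_Suc)
    from LIMSEQ_subseq_LIMSEQ[OF this r]
    show "(\<lambda>n. \<integral>t. cis (- (of_int k * t)) \<partial>M (r n)) \<longlonglongrightarrow> c k" by (simp add: o_def)
  qed
  \<comment> \<open>The weak limit is only known to live on the closed interval and may have an atom
    at \<open>2 * pi\<close>. On the circle this is the point 0, where all characters take the same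
    value.\<close>
  define p where "p t = (if t \<in> {0..<2 * pi} then t else 0)" for t :: real
  have p: "p \<in> measurable N circle_borel"
    unfolding circle_borel_def
  proof (rule measurable_restrict_space2)
    show "p \<in> space N \<rightarrow> {0..<2 * pi}" by (auto simp: p_def)
    have "p \<in> measurable borel borel" unfolding p_def[abs_def] by measurable
    then show "p \<in> measurable N borel" by simp
  qed
  show thesis
  proof (rule that[of "distr N circle_borel p"])
    show "prob_space (distr N circle_borel p)" using p by (rule N.prob_space_distr)
    fix k :: int
    have "(\<integral>t. cis (- (of_int k * t)) \<partial>distr N circle_borel p) = (\<integral>t. cis (- (of_int k * p t)) \<partial>N)"
    proof (rule integral_distr[OF p])
      show "(\<lambda>t. cis (- (of_int k * t))) \<in> borel_measurable circle_borel"
        unfolding circle_borel_def using cism[of "- of_int k"] by (intro measurable_restrict_space1) simp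
    qed
    also have "\<dots> = (\<integral>t. cis (- (of_int k * t)) \<partial>N)"
    proof (rule integral_cong_AE)
      show "(\<lambda>t. cis (- (of_int k * t))) \<in> borel_measurable N" using cism[of "- of_int k"] by simp
      have "(\<lambda>t. cis (- (of_int k * p t))) \<in> borel_measurable borel"
        using measurable_compose[OF _ cism[of "- of_int k"], of p borel] unfolding p_def[abs_def] by simp
      then show "(\<lambda>t. cis (- (of_int k * p t))) \<in> borel_measurable N" by simp
      have per: "cis (- (of_int k * (2 * pi))) = 1"
        using cis_multiple_2pi[of "of_int (- k)"] by (simp add: mult.commute)
      show "AE t in N. cis (- (of_int k * p t)) = cis (- (of_int k * t))"
        using NC
      proof eventually_elim
        fix t assume "t \<in> {0..2 * pi}"
        then have "t \<in> {0..<2 * pi} \<or> t = 2 * pi" by auto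
        then show "cis (- (of_int k * p t)) = cis (- (of_int k * t))"
          using per by (auto simp: p_def)
      qed
    qed
    finally show "(\<integral>t. cis (- (of_int k * t)) \<partial>distr N circle_borel p) = c k" using intN by simp
  qed simp
qed

section \<open>Polynomial approximation for singular measures\<close>

lemma norm_sum_squared:
  fixes x :: "'b \<Rightarrow> complex"
  shows "complex_of_real ((norm (\<Sum>i\<in>A. x i))\<^sup>2) = (\<Sum>i\<in>A. \<Sum>j\<in>A. x i * cnj (x j))"
  unfolding complex_norm_square cnj_sum sum_product ..

text \<open>It turns smallness in quadratic mean for Lebesgue measure into smallness of the
  coefficients, the quantity that governs the filtered sequence later.\<close>

lemma parseval_poly:
  fixes p :: "complex poly"
  shows "(\<integral>t. (norm (poly p (cis (- t))))\<^sup>2 \<partial>circle_uniform) = (\<Sum>k\<le>degree p. (norm (coeff p k))\<^sup>2)"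
proof -
  interpret U: prob_space circle_uniform by (rule prob_space_circle_uniform)
  have icis: "integrable circle_uniform (\<lambda>t. cis (a * t))" for a
    by (intro U.integrable_const_bound[where B=1]) auto
  have expand: "complex_of_real ((norm (poly p (cis (- t))))\<^sup>2) =
      (\<Sum>i\<le>degree p. \<Sum>j\<le>degree p. (coeff p i * cnj (coeff p j)) * cis (of_int (int j - int i) * t))" for t
    unfolding poly_altdef norm_sum_squared
    by (intro sum.cong refl) (simp add: Complex.DeMoivre cis_cnj cis_mult algebra_simps)
  have "complex_of_real (\<integral>t. (norm (poly p (cis (- t))))\<^sup>2 \<partial>circle_uniform) =
      (\<integral>t. complex_of_real ((norm (poly p (cis (- t))))\<^sup>2) \<partial>circle_uniform)"
    by (rule integral_complex_of_real[symmetric])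
  also have "\<dots> = (\<Sum>i\<le>degree p. \<Sum>j\<le>degree p. (coeff p i * cnj (coeff p j)) * of_bool (int j - int i = 0))"
    unfolding expand using icis
    by (simp add: Bochner_Integration.integral_sum integral_circle_uniform_cis del: of_int_diff)
  also have "\<dots> = (\<Sum>i\<le>degree p. coeff p i * cnj (coeff p i))"
  proof (rule sum.cong)
    fix i assume "i \<in> {..degree p}"
    have "(\<Sum>j\<le>degree p. (coeff p i * cnj (coeff p j)) * of_bool (int j - int i = 0)) =
        (\<Sum>j\<le>degree p. if i = j then coeff p i * cnj (coeff p j) else 0)"
      by (intro sum.cong) auto
    also have "\<dots> = coeff p i * cnj (coeff p i)"
      using \<open>i \<in> {..degree p}\<close> by (subst sum.delta') auto
    finally show "(\<Sum>j\<le>degree p. (coeff p i * cnj (coeff p j)) * of_bool (int j - int i = 0)) =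
      coeff p i * cnj (coeff p i)" .
  qed simp
  also have "\<dots> = complex_of_real (\<Sum>k\<le>degree p. (norm (coeff p k))\<^sup>2)"
    by (simp add: complex_norm_square[symmetric])
  finally show ?thesis by (simp only: of_real_eq_iff)
qed

text \<open>Trigonometric polynomials are encoded as complex polynomials up to a power of z.\<close>

lemma real_polynomial_function_circle:
  fixes q :: "complex \<Rightarrow> real"
  assumes "real_polynomial_function q"
  shows "\<exists>n p. \<forall>z. norm z = 1 \<longrightarrow> z ^ n * of_real (q z) = poly p z"
  using assms
proof induction
  case (linear f)
  interpret bounded_linear f by fact
  define a b where "a = complex_of_real (f 1)" and "b = complex_of_real (f \<i>)"
  \<comment> \<open>A real linear form is a combination of z and its conjugate, which is the inverse
    of z on the unit circle, so one factor z clears the only negative power.\<close>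
  have "z ^ 1 * of_real (f z) = poly [:a / 2 + \<i> * b / 2, 0, a / 2 - \<i> * b / 2:] z" if "norm z = 1" for z
  proof -
    have zc: "z * cnj z = 1" using that complex_norm_square[of z] by simp
    have "f z = f (Re z *\<^sub>R 1 + Im z *\<^sub>R \<i>)"
      by (intro arg_cong[where f=f]) (simp add: complex_eq_iff)
    then have "f z = Re z * f 1 + Im z * f \<i>" by (simp only: add scaleR real_scaleR_def)
    then have "of_real (f z) = of_real (Re z) * a + of_real (Im z) * b" by (simp add: a_def b_def)
    moreover have "of_real (Re z) = (z + cnj z) / 2" "of_real (Im z) = - \<i> * (z - cnj z) / 2"
      by (auto simp: complex_eq_iff)
    ultimately have fz: "of_real (f z) = (z + cnj z) / 2 * a - \<i> * (z - cnj z) / 2 * b" by simp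
    have "z * of_real (f z) = (z * z + z * cnj z) / 2 * a - \<i> * (z * z - z * cnj z) / 2 * b"
      unfolding fz by (simp add: algebra_simps)
    then show ?thesis unfolding zc by (simp add: algebra_simps add_divide_distrib diff_divide_distrib)
  qed
  then show ?case by blast
next
  case (const c)
  have "z ^ 0 * of_real c = poly [:of_real c:] z" for z :: complex by simp
  then show ?case by blast
next
  case (add f g)
  then obtain m p n r where f: "\<And>z. norm z = 1 \<Longrightarrow> z ^ m * of_real (f z) = poly p z"
    and g: "\<And>z. norm z = 1 \<Longrightarrow> z ^ n * of_real (g z) = poly r z" by blast
  have "z ^ (m + n) * of_real (f z + g z) = poly (monom 1 n * p + monom 1 m * r) z" if "norm z = 1" for z
    using f[OF that, symmetric] g[OF that, symmetric] by (simp add: poly_monom power_add algebra_simps)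
  then show ?case by blast
next
  case (mult f g)
  then obtain m p n r where f: "\<And>z. norm z = 1 \<Longrightarrow> z ^ m * of_real (f z) = poly p z"
    and g: "\<And>z. norm z = 1 \<Longrightarrow> z ^ n * of_real (g z) = poly r z" by blast
  have "z ^ (m + n) * of_real (f z * g z) = poly (p * r) z" if "norm z = 1" for z
    using f[OF that, symmetric] g[OF that, symmetric] by (simp add: power_add algebra_simps)
  then show ?case by blast
qed

lemma power2_triangle: "norm (a - b) \<le> d \<Longrightarrow> (norm a)\<^sup>2 \<le> 2 * (norm b)\<^sup>2 + 2 * d\<^sup>2"
  for a b :: "'a::real_normed_vector"
proof -
  assume "norm (a - b) \<le> d"
  then have "norm a \<le> norm b + d" using norm_triangle_ineq2[of a b] by linarith
  then have "(norm a)\<^sup>2 \<le> (norm b + d)\<^sup>2" by (intro power_mono) auto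
  also have "\<dots> \<le> 2 * (norm b)\<^sup>2 + 2 * d\<^sup>2"
    using sum_squares_bound[of "norm b" d] by (simp add: power2_eq_square algebra_simps)
  finally show ?thesis .
qed

lemma measurable_circle:
  assumes "sets \<tau> = sets circle_borel" "g \<in> measurable borel N"
  shows "g \<in> measurable \<tau> N"
  using measurable_restrict_space1[OF assms(2), of "{0..<2 * pi}"]
  unfolding measurable_cong_sets[OF assms(1) refl, of N] circle_borel_def .

text \<open>\<open>\<tau>\<close> is carried by the Lebesgue null set B, and up to small mass by a
  compact K. A continuous cutoff equal to 1 on K and concentrated near K is close to 1 for
  \<open>\<tau>\<close> and, as K is a null set, close to 0 for Lebesgue measure. Stone-Weierstrass
  on the circle replaces it by a real polynomial q in the coordinates, and p is q times a power of
  z. The second bound is the Lebesgue one, expressed through \<open>parseval_poly\<close>.\<close>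

lemma singular_poly_approximation:
  assumes \<tau>: "sets \<tau> = sets circle_borel" "finite_measure \<tau>"
    and B: "B \<in> sets circle_borel" "emeasure \<tau> (space \<tau> - B) = 0" "emeasure circle_lebesgue B = 0"
    and e: "e > 0"
  obtains n and p :: "complex poly"
  where "(\<integral>t. (norm (cis (- t) ^ n - poly p (cis (- t))))\<^sup>2 \<partial>\<tau>) < e"
    "(\<Sum>k\<le>degree p. (norm (coeff p k))\<^sup>2) < e"
proof -
  interpret \<tau>: finite_measure \<tau> by fact
  interpret U: prob_space circle_uniform by (rule prob_space_circle_uniform)
  let ?C = "{0..<2 * pi}"
  have spC: "space \<tau> = ?C" using sets_eq_imp_space_eq[OF \<tau>(1)]
    by (simp add: circle_borel_def space_restrict_space)
  have sets\<tau>: "A \<in> sets \<tau> \<longleftrightarrow> A \<in> sets borel \<and> A \<subseteq> ?C" for A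
    unfolding \<tau>(1) circle_borel_def by (auto simp: sets_restrict_space_iff)
  have BC: "B \<in> sets borel" "B \<subseteq> ?C" "B \<in> sets \<tau>" using B(1) sets\<tau> \<tau>(1) by auto
  have idm: "id \<in> measurable \<tau> borel"
    using \<tau>(1) by (rule measurable_circle) simp
  \<comment> \<open>Inner regularity applies to Borel measures on the line, while
    \<open>\<tau>\<close> lives on a restricted space.\<close>
  define \<tau>' where "\<tau>' = distr \<tau> borel id"
  have em\<tau>': "emeasure \<tau>' A = emeasure \<tau> A" if "A \<in> sets borel" "A \<subseteq> ?C" for A
    unfolding \<tau>'_def using that idm spC by (subst emeasure_distr) (auto simp: Int_absorb2)
  have reg: "emeasure \<tau>' B = (SUP K\<in>{K. K \<subseteq> B \<and> compact K}. emeasure \<tau>' K)"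
  proof (rule inner_regular)
    show "emeasure \<tau>' (space \<tau>') \<noteq> \<infinity>"
      using finite_measure.emeasure_finite[OF \<tau>.finite_measure_distr[OF idm]] by (simp add: \<tau>'_def)
  qed (use BC in \<open>auto simp: \<tau>'_def\<close>)
  obtain K0 where K0: "K0 \<subseteq> B" "compact K0" "measure \<tau> B - e / 16 < measure \<tau> K0"
  proof (cases "measure \<tau> B - e / 16 < 0")
    case True
    then show ?thesis using that[of "{}"] by simp
  next
    case False
    have "ennreal (measure \<tau> B - e / 16) < emeasure \<tau>' B"
      unfolding em\<tau>'[OF BC(1,2)] \<tau>.emeasure_eq_measure using e False by (intro ennreal_lessI) auto
    then obtain K where K: "K \<subseteq> B" "compact K" "ennreal (measure \<tau> B - e / 16) < emeasure \<tau>' K"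
      unfolding reg less_SUP_iff by auto
    have "K \<in> sets borel" "K \<subseteq> ?C" using K BC by (auto simp: compact_imp_closed)
    then have "measure \<tau> B - e / 16 < measure \<tau> K"
      using K(3) False by (simp add: em\<tau>' \<tau>.emeasure_eq_measure ennreal_less_iff)
    with K show ?thesis using that by blast
  qed
  \<comment> \<open>The extra point is Lebesgue null and keeps K nonempty: \<open>infdist\<close> to
    the empty set is 0 by convention, so the cutoff would be constantly 1.\<close>
  define K where "K = insert 0 K0"
  have K: "compact K" "K \<noteq> {}" "K \<subseteq> ?C" "K \<in> sets borel"
    using K0 BC by (auto simp: K_def compact_imp_closed)
  have "K \<in> sets \<tau>" "K0 \<in> sets \<tau>" using K K0 BC by (auto simp: sets\<tau> compact_imp_closed)
  have \<tau>K: "measure \<tau> (?C - K) < e / 16"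
  proof -
    have "measure \<tau> (?C - K) = measure \<tau> ?C - measure \<tau> K"
      using \<tau>.finite_measure_compl[OF \<open>K \<in> sets \<tau>\<close>] by (simp add: spC)
    moreover have "measure \<tau> ?C = measure \<tau> B"
      using \<tau>.finite_measure_compl[OF BC(3)] B(2) by (simp add: spC measure_def)
    moreover have "measure \<tau> K0 \<le> measure \<tau> K"
      using \<open>K \<in> sets \<tau>\<close> by (intro \<tau>.finite_measure_mono) (auto simp: K_def)
    ultimately show ?thesis using K0(3) by linarith
  qed
  have UK: "emeasure circle_uniform K = 0"
  proof -
    have "emeasure lborel B = 0"
      using B(3) BC unfolding circle_lebesgue_def by (subst (asm) emeasure_restrict_space) auto
    then have "emeasure lborel (insert 0 B) = 0"
      using BC by (subst insert_is_Un, subst emeasure_Un_null_set) (auto simp: null_sets_def)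
    moreover have "?C \<inter> K \<subseteq> insert 0 B" "insert 0 B \<in> sets lborel" using K0(1) BC by (auto simp: K_def)
    ultimately have "emeasure lborel (?C \<inter> K) = 0" using emeasure_eq_0 by blast
    then show ?thesis using K unfolding circle_uniform_def by simp
  qed
  define L where "L = (\<lambda>t. cis (- t)) ` K"
  have L: "compact L" "L \<noteq> {}" using K unfolding L_def
    by (auto intro!: compact_continuous_image continuous_intros)
  have cis_L: "t \<in> K" if "cis (- t) \<in> L" "t \<in> ?C" for t
  proof -
    obtain u where u: "u \<in> K" "cis (- t) = cis (- u)" using \<open>cis (- t) \<in> L\<close> unfolding L_def by blast
    have "cis t = cis u" using arg_cong[OF u(2), of cnj] by (simp add: cis_cnj)
    moreover have "u \<in> ?C" using K(3) u(1) by blast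
    ultimately have "t = u" using \<open>t \<in> ?C\<close> Arg2pi_unique[of 1 t "cis t"] Arg2pi_unique[of 1 u "cis t"]
      by (simp add: cis_conv_exp)
    then show ?thesis using u by simp
  qed
  \<comment> \<open>Distances are taken in the plane, to the image L of K on the unit circle, so the
    cutoff is continuous also where 0 and \<open>2 * pi\<close> are glued.\<close>
  define \<phi> where "\<phi> m w = max 0 (1 - real m * infdist w L)" for m w
  have \<phi>01: "0 \<le> \<phi> m w" "\<phi> m w \<le> 1" for m w by (auto simp: \<phi>_def infdist_nonneg)
  have \<phi>c: "continuous_on UNIV (\<phi> m)" for m
    unfolding \<phi>_def[abs_def] by (intro continuous_intros continuous_on_infdist)
  have \<phi>K: "\<phi> m (cis (- t)) = 1" if "t \<in> K" for m t
    using that by (auto simp: \<phi>_def L_def)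
  have \<phi>m [measurable]: "(\<lambda>t. \<phi> m (cis (- t))) \<in> borel_measurable borel" for m
    using borel_measurable_continuous_onI[OF \<phi>c] by measurable
  have "(\<lambda>m. \<integral>t. (\<phi> m (cis (- t)))\<^sup>2 \<partial>circle_uniform) \<longlonglongrightarrow> (\<integral>t. indicat_real K t \<partial>circle_uniform)"
  proof (rule integral_dominated_convergence[where w="\<lambda>_. 1"])
    have "AE t in circle_uniform. t \<in> ?C"
      unfolding circle_uniform_def by (rule AE_uniform_measureI) auto
    then show "AE t in circle_uniform. (\<lambda>m. (\<phi> m (cis (- t)))\<^sup>2) \<longlonglongrightarrow> indicat_real K t"
    proof eventually_elim
      fix t assume t: "t \<in> ?C"
      show "(\<lambda>m. (\<phi> m (cis (- t)))\<^sup>2) \<longlonglongrightarrow> indicat_real K t"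
      proof (cases "t \<in> K")
        case True
        then show ?thesis by (simp add: \<phi>K)
      next
        case False
        then have "cis (- t) \<notin> L" using cis_L t by blast
        then have "infdist (cis (- t)) L > 0"
          using L infdist_pos_not_in_closed compact_imp_closed by metis
        then obtain m0 where m0: "1 < real m0 * infdist (cis (- t)) L" using reals_Archimedean3 by blast
        have "\<phi> m (cis (- t)) = 0" if "m \<ge> m0" for m
        proof -
          have "real m0 * infdist (cis (- t)) L \<le> real m * infdist (cis (- t)) L"
            using that by (intro mult_right_mono) (auto simp: infdist_nonneg)
          then show ?thesis using m0 by (simp add: \<phi>_def)
        qed
        then show ?thesis using False
          by (intro tendsto_eventually) (auto simp: eventually_sequentially)
      qed
    qed
    show "AE t in circle_uniform. norm ((\<phi> m (cis (- t)))\<^sup>2) \<le> 1" for m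
      using \<phi>01 by (auto simp: power_le_one)
  qed (use K in auto)
  then have "(\<lambda>m. \<integral>t. (\<phi> m (cis (- t)))\<^sup>2 \<partial>circle_uniform) \<longlonglongrightarrow> 0"
    using K UK by (simp add: measure_def)
  then have "\<forall>\<^sub>F m in sequentially. (\<integral>t. (\<phi> m (cis (- t)))\<^sup>2 \<partial>circle_uniform) < e / 16"
    using e by (intro order_tendstoD(2)) auto
  then obtain m where m: "(\<integral>t. (\<phi> m (cis (- t)))\<^sup>2 \<partial>circle_uniform) < e / 16"
    by (auto simp: eventually_sequentially)
  \<comment> \<open>The uniform error d is tuned to both measures at once: its square is at most
    e/16, and so is its square times the total mass of \<open>\<tau>\<close>.\<close>
  define d where "d = sqrt (e / (16 * (1 + measure \<tau> ?C)))"
  have pos1: "1 + measure \<tau> ?C > 0" by (simp add: add_pos_nonneg)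
  have d: "d > 0" "d\<^sup>2 * (1 + measure \<tau> ?C) = e / 16" using e pos1 by (auto simp: d_def field_simps)
  have d1: "d\<^sup>2 \<le> e / 16" "d\<^sup>2 * measure \<tau> ?C \<le> e / 16"
  proof -
    have "d\<^sup>2 + d\<^sup>2 * measure \<tau> ?C = e / 16" using d(2) by (simp add: distrib_left)
    moreover have "0 \<le> d\<^sup>2" "0 \<le> d\<^sup>2 * measure \<tau> ?C" by simp_all
    ultimately show "d\<^sup>2 \<le> e / 16" "d\<^sup>2 * measure \<tau> ?C \<le> e / 16" by linarith+
  qed
  obtain q where q: "real_polynomial_function q" "\<And>w. w \<in> sphere 0 1 \<Longrightarrow> \<bar>\<phi> m w - q w\<bar> < d"
    by (rule Stone_Weierstrass_real_polynomial_function[OF compact_sphere continuous_on_subset[OF \<phi>c subset_UNIV] d(1)])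
      (rule that)
  obtain n p where np: "\<And>z. norm z = 1 \<Longrightarrow> z ^ n * of_real (q z) = poly p z"
    using real_polynomial_function_circle[OF q(1)] by blast
  show thesis
  proof (rule that[of n p])
    \<comment> \<open>The factor \<open>cis (- t) ^ n\<close> has modulus 1, so this is the distance
      of q from 1: the cutoff equals 1 on K, differs from 1 by at most 1 elsewhere, and q is within
      d of it.\<close>
    have bound: "(norm (cis (- t) ^ n - poly p (cis (- t))))\<^sup>2 \<le> 2 * indicator (?C - K) t + 2 * d\<^sup>2"
      if "t \<in> ?C" for t
    proof -
      have "cis (- t) ^ n - poly p (cis (- t)) = cis (- t) ^ n * of_real (1 - q (cis (- t)))"
        using np[of "cis (- t)"] by (simp add: algebra_simps)
      then have "norm (cis (- t) ^ n - poly p (cis (- t))) = \<bar>1 - q (cis (- t))\<bar>"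
        by (simp add: norm_mult norm_power del: of_real_diff)
      moreover have "(norm (1 - q (cis (- t))))\<^sup>2 \<le> 2 * (norm (1 - \<phi> m (cis (- t))))\<^sup>2 + 2 * d\<^sup>2"
        using q(2)[of "cis (- t)"] by (intro power2_triangle) auto
      moreover have "(norm (1 - \<phi> m (cis (- t))))\<^sup>2 \<le> indicator (?C - K) t"
        using \<phi>K[of t m] \<phi>01[of m "cis (- t)"] that
        by (auto simp: indicator_def abs_square_le_1 abs_le_iff)
      ultimately show ?thesis by (simp add: power2_abs)
    qed
    have cm: "(\<lambda>t. (norm (cis (- t) ^ n - poly p (cis (- t))))\<^sup>2) \<in> borel_measurable \<tau>"
      by (intro measurable_circle[OF \<tau>(1)] borel_measurable_continuous_onI continuous_intros)
    have CK: "?C - K \<in> sets \<tau>" using K(4) by (auto simp: sets\<tau>)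
    have i1: "integrable \<tau> (\<lambda>t. 2 * indicat_real (?C - K) t + 2 * d\<^sup>2)"
      using CK by (intro Bochner_Integration.integrable_add integrable_mult_right \<tau>.integrable_const integrable_real_indicator)
        (auto simp: \<tau>.emeasure_eq_measure)
    have "(\<integral>t. (norm (cis (- t) ^ n - poly p (cis (- t))))\<^sup>2 \<partial>\<tau>) \<le> (\<integral>t. 2 * indicator (?C - K) t + 2 * d\<^sup>2 \<partial>\<tau>)"
    proof (rule integral_mono[OF _ i1])
      show "integrable \<tau> (\<lambda>t. (norm (cis (- t) ^ n - poly p (cis (- t))))\<^sup>2)"
        by (rule Bochner_Integration.integrable_bound[OF i1 cm]) (use bound in \<open>auto simp: spC intro!: AE_I2\<close>)
    qed (use bound spC in auto)
    also have "\<dots> = 2 * measure \<tau> (?C - K) + 2 * d\<^sup>2 * measure \<tau> ?C"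
      using CK by (subst Bochner_Integration.integral_add) (auto simp: spC \<tau>.emeasure_eq_measure Int_absorb2)
    also have "\<dots> < e" using \<tau>K d1 e by linarith
    finally show "(\<integral>t. (norm (cis (- t) ^ n - poly p (cis (- t))))\<^sup>2 \<partial>\<tau>) < e" .
    have i2: "integrable circle_uniform (\<lambda>t. 2 * (\<phi> m (cis (- t)))\<^sup>2 + 2 * d\<^sup>2)"
      using \<phi>01 by (intro Bochner_Integration.integrable_add integrable_mult_right U.integrable_const
          U.integrable_const_bound[where B=1]) (auto simp: power_le_one)
    have bound2: "(norm (poly p (cis (- t))))\<^sup>2 \<le> 2 * (\<phi> m (cis (- t)))\<^sup>2 + 2 * d\<^sup>2" for t
    proof -
      have "norm (poly p (cis (- t))) = norm (q (cis (- t)))"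
        using np[of "cis (- t)", symmetric] by (simp add: norm_mult norm_power)
      moreover have "(norm (q (cis (- t))))\<^sup>2 \<le> 2 * (norm (\<phi> m (cis (- t))))\<^sup>2 + 2 * d\<^sup>2"
        using q(2)[of "cis (- t)"] by (intro power2_triangle) (auto simp: abs_minus_commute)
      ultimately show ?thesis by simp
    qed
    have "(\<Sum>k\<le>degree p. (norm (coeff p k))\<^sup>2) = (\<integral>t. (norm (poly p (cis (- t))))\<^sup>2 \<partial>circle_uniform)"
      by (rule parseval_poly[symmetric])
    also have "\<dots> \<le> (\<integral>t. 2 * (\<phi> m (cis (- t)))\<^sup>2 + 2 * d\<^sup>2 \<partial>circle_uniform)"
    proof (rule integral_mono[OF _ i2])
      show "integrable circle_uniform (\<lambda>t. (norm (poly p (cis (- t))))\<^sup>2)"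
      proof (rule Bochner_Integration.integrable_bound[OF i2])
        show "(\<lambda>t. (norm (poly p (cis (- t))))\<^sup>2) \<in> borel_measurable circle_uniform"
          unfolding measurable_cong_sets[OF sets_circle_uniform refl]
          by (intro borel_measurable_continuous_onI continuous_intros)
      qed (use bound2 in auto)
    qed (use bound2 in auto)
    also have "\<dots> = 2 * (\<integral>t. (\<phi> m (cis (- t)))\<^sup>2 \<partial>circle_uniform) + 2 * d\<^sup>2"
      using \<phi>01 by (subst Bochner_Integration.integral_add)
        (auto intro!: U.integrable_const_bound[where B=1] simp: power_le_one U.prob_space[simplified])
    also have "\<dots> < e" using m d1 e by linarith
    finally show "(\<Sum>k\<le>degree p. (norm (coeff p k))\<^sup>2) < e" .
  qed
qed

section \<open>Time averages and spectral measures\<close>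

text \<open>Time averages along an orbit are integrals with respect to the empirical measures, whose weak
  limits are invariant.\<close>

theorem uniquely_ergodic_time_average:
  fixes T :: "'a::metric_space \<Rightarrow> 'a" and h :: "'a \<Rightarrow> real"
  assumes ue: "uniquely_ergodic T P" and h: "continuous_on UNIV h" and e: "e > 0"
  shows "\<forall>\<^sub>F N in sequentially. (\<Sum>n=1..N. h ((T ^^ n) y)) / N < (\<integral>x. h x \<partial>P) + e"
proof (rule ccontr)
  assume "\<not> ?thesis"
  from not_eventually_sequentiallyD[OF this]
  obtain r0 where r0: "strict_mono (r0 :: nat \<Rightarrow> nat)"
    "\<And>n. (\<integral>x. h x \<partial>P) + e \<le> (\<Sum>k=1..r0 n. h ((T ^^ k) y)) / r0 n"
    by (auto simp: not_less)
  \<comment> \<open>Dropping the first index ensures that \<open>s n\<close> is at least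
    \<open>Suc n\<close>, so that no average is empty and the boundary terms decay like
    \<open>1 / Suc n\<close>.\<close>
  define s where "s n = r0 (Suc n)" for n
  have sn: "Suc n \<le> s n" for n unfolding s_def by (rule seq_suble[OF r0(1)])
  have comp: "compact (UNIV :: 'a set)" and T: "continuous_on UNIV T"
    using ue by (auto simp: uniquely_ergodic_def homeomorphism_def)
  define Q where "Q n = distr (measure_pmf (pmf_of_set {1..s n})) borel (\<lambda>k. (T ^^ k) y)" for n
  have intQ: "(\<integral>x. k x \<partial>Q n) = (\<Sum>i=1..s n. k ((T ^^ i) y)) / s n"
    if "continuous_on UNIV k" for k :: "'a \<Rightarrow> real" and n
    using borel_measurable_continuous_onI[OF that] sn[of n] unfolding Q_def
    by (simp add: integral_distr integral_pmf_of_set)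
  have asym: "(\<lambda>n. (\<integral>x. k (T x) \<partial>Q n) - (\<integral>x. k x \<partial>Q n)) \<longlonglongrightarrow> 0"
    if k: "continuous_on UNIV k" for k :: "'a \<Rightarrow> real"
  proof -
    obtain B where B: "\<And>x. \<bar>k x\<bar> \<le> B"
      using compact_imp_bounded[OF compact_continuous_image[OF k comp]] by (auto simp: bounded_iff)
    have kT: "continuous_on UNIV (\<lambda>x. k (T x))" using continuous_on_compose2[OF k T] by simp
    \<comment> \<open>The two orbit sums differ by one step and telescope, leaving two boundary
      terms.\<close>
    have eq: "(\<integral>x. k (T x) \<partial>Q n) - (\<integral>x. k x \<partial>Q n) = (k ((T ^^ Suc (s n)) y) - k (T y)) / s n" for n
    proof -
      have "(\<Sum>i=1..s n. k ((T ^^ Suc i) y) - k ((T ^^ i) y)) = k ((T ^^ Suc (s n)) y) - k ((T ^^ 1) y)"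
        by (rule sum_Suc_diff) simp
      then show ?thesis
        unfolding intQ[OF kT] intQ[OF k] by (simp add: sum_subtractf flip: diff_divide_distrib)
    qed
    have "(\<lambda>n. 2 * B * (1 / real (Suc n))) \<longlonglongrightarrow> 2 * B * 0"
      by (intro tendsto_intros LIMSEQ_Suc[OF lim_1_over_n])
    then have "(\<lambda>n. 2 * B * (1 / real (Suc n))) \<longlonglongrightarrow> 0" by simp
    then show ?thesis
    proof (rule Lim_null_comparison[rotated], intro always_eventually allI)
      fix n
      have "\<bar>k ((T ^^ Suc (s n)) y) - k (T y)\<bar> \<le> 2 * B"
        using B[of "(T ^^ Suc (s n)) y"] B[of "T y"] by linarith
      then have "\<bar>k ((T ^^ Suc (s n)) y) - k (T y)\<bar> / s n \<le> 2 * B / Suc n"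
        using sn[of n] by (intro frac_le) auto
      then show "norm ((\<integral>x. k (T x) \<partial>Q n) - (\<integral>x. k x \<partial>Q n)) \<le> 2 * B * (1 / real (Suc n))"
        unfolding eq by simp
    qed
  qed
  have "\<And>n. prob_space (Q n)" "\<And>n. sets (Q n) = sets borel"
    unfolding Q_def by (auto intro!: measure_pmf.prob_space_distr)
  then obtain r R where R: "invariant_prob T R" "converges_weakly (\<lambda>n. Q (r n)) R"
    using invariant_prob_seq_compact[OF comp T _ _ asym] by metis
  then have "(\<lambda>n. \<integral>x. h x \<partial>Q (r n)) \<longlonglongrightarrow> (\<integral>x. h x \<partial>R)"
    using h by (simp add: converges_weakly_def)
  moreover have "(\<integral>x. h x \<partial>P) + e \<le> (\<integral>x. h x \<partial>Q (r n))" for n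
    unfolding intQ[OF h] using r0(2) by (simp add: s_def)
  ultimately have "(\<integral>x. h x \<partial>P) + e \<le> (\<integral>x. h x \<partial>R)" by (intro LIMSEQ_le_const) auto
  with uniquely_ergodic_integral_le[OF ue R(1) h] e show False by linarith
qed

section \<open>Correlations and spectral measures of continuous functions\<close>

locale compact_system =
  fixes T :: "'a::metric_space \<Rightarrow> 'a" and P :: "'a measure"
  assumes compact_space: "compact (UNIV :: 'a set)"
    and homeo: "homeomorphism UNIV UNIV T (inv T)"
    and invariant: "invariant_prob T P"
begin

lemma bij_T: "bij T"
  using homeo by (metis UNIV_I bijI' homeomorphism_def)

lemma sets_P: "sets P = sets borel" and prob_space_P: "prob_space P"
  using invariant by (auto simp: invariant_prob_def)

lemma continuous_funpow:
  fixes g :: "'b::topological_space \<Rightarrow> 'b"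
  assumes "continuous_on UNIV g"
  shows "continuous_on UNIV (g ^^ n)"
proof (induction n)
  case (Suc n)
  then show ?case using continuous_on_compose[of UNIV "g ^^ n" g] assms
    by (auto intro: continuous_on_subset)
qed (simp add: id_def)

lemma continuous_T: "continuous_on UNIV T" and continuous_inv_T: "continuous_on UNIV (inv T)"
  using homeo by (auto simp: homeomorphism_def)

lemma continuous_iter: "continuous_on UNIV (iter T k)"
  unfolding iter_def using continuous_funpow[OF continuous_T] continuous_funpow[OF continuous_inv_T] by simp

lemma integrable_P:
  fixes h :: "'a \<Rightarrow> 'b::{banach, second_countable_topology}"
  assumes "continuous_on UNIV h" shows "integrable P h"
  using compact_space prob_space_P sets_P assms
  by (intro integrable_continuous_compact prob_space.finite_measure)

lemma integral_funpow:
  fixes h :: "'a \<Rightarrow> 'b::{banach, second_countable_topology}"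
  assumes h: "continuous_on UNIV h"
  shows "(\<integral>x. h ((T ^^ n) x) \<partial>P) = (\<integral>x. h x \<partial>P)"
proof (induction n)
  case (Suc n)
  have "continuous_on UNIV (\<lambda>x. h ((T ^^ n) x))"
    using continuous_on_compose2[OF h continuous_funpow[OF continuous_T]] by simp
  then have "(\<integral>x. h ((T ^^ n) (T x)) \<partial>P) = (\<integral>x. h ((T ^^ n) x) \<partial>P)"
    using continuous_T by (intro invariant_prob_integral[OF invariant, where h="\<lambda>x. h ((T ^^ n) x)"] borel_measurable_continuous_onI)
  then show ?case using Suc by (simp add: funpow_swap1)
qed simp

text \<open>With invariance of P under \<open>T ^^ j\<close>, this makes the correlation of two
  iterates of f depend only on the signed lag i - j.\<close>

lemma iter_diff: "iter T (int i - int j) ((T ^^ j) x) = (T ^^ i) x"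
proof (cases "j \<le> i")
  case True
  then have "nat (int i - int j) = i - j" by simp
  moreover have "(T ^^ (i - j)) ((T ^^ j) x) = (T ^^ i) x"
    using True funpow_add[of "i - j" j T] by simp
  ultimately show ?thesis using True by (simp add: iter_def)
next
  case False
  then have j: "j = (j - i) + i" and n: "nat (- (int i - int j)) = j - i" by auto
  have "(T ^^ j) x = (T ^^ (j - i)) ((T ^^ i) x)"
    by (subst j, subst funpow_add) simp
  moreover have "(inv T ^^ (j - i)) ((T ^^ (j - i)) z) = z" for z
    using inv_fn_o_fn_is_id[OF bij_T, of "j - i"] by (metis comp_apply)
  ultimately show ?thesis using False n by (simp add: iter_def)
qed

definition correlation :: "('a \<Rightarrow> complex) \<Rightarrow> int \<Rightarrow> complex" where
  "correlation f k = (\<integral>x. f (iter T k x) * cnj (f x) \<partial>P)"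

text \<open>This Gram identity is used twice: it shows that the correlations are positive definite,
  and it is one half of the spectral isometry.\<close>

lemma integral_norm_sum:
  fixes f :: "'a \<Rightarrow> complex"
  assumes f: "continuous_on UNIV f"
  shows "complex_of_real (\<integral>x. (norm (\<Sum>i\<in>A. z i * f ((T ^^ i) x)))\<^sup>2 \<partial>P) =
    (\<Sum>i\<in>A. \<Sum>j\<in>A. z i * cnj (z j) * correlation f (int i - int j))"
proof -
  have cf: "continuous_on UNIV (\<lambda>x. f ((T ^^ i) x))" for i
    using continuous_on_compose2[OF f continuous_funpow[OF continuous_T]] by simp
  have cc: "continuous_on UNIV (\<lambda>x. f (iter T k x) * cnj (f x))" for k
    using continuous_on_compose2[OF f continuous_iter] f by (auto intro!: continuous_intros)
  have corr: "(\<integral>x. f ((T ^^ i) x) * cnj (f ((T ^^ j) x)) \<partial>P) = correlation f (int i - int j)" for i j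
    using integral_funpow[OF cc, of "int i - int j" j] by (simp add: iter_diff correlation_def)
  have "complex_of_real (\<integral>x. (norm (\<Sum>i\<in>A. z i * f ((T ^^ i) x)))\<^sup>2 \<partial>P) =
      (\<integral>x. complex_of_real ((norm (\<Sum>i\<in>A. z i * f ((T ^^ i) x)))\<^sup>2) \<partial>P)"
    by (rule integral_complex_of_real[symmetric])
  also have "\<dots> = (\<integral>x. (\<Sum>i\<in>A. \<Sum>j\<in>A. z i * cnj (z j) * (f ((T ^^ i) x) * cnj (f ((T ^^ j) x)))) \<partial>P)"
    unfolding norm_sum_squared by (intro Bochner_Integration.integral_cong sum.cong refl) simp
  also have "\<dots> = (\<Sum>i\<in>A. \<Sum>j\<in>A. z i * cnj (z j) * correlation f (int i - int j))"
  proof -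
    have "integrable P (\<lambda>x. f ((T ^^ i) x) * cnj (f ((T ^^ j) x)))" for i j
      using cf by (intro integrable_P continuous_intros)
    then show ?thesis by (simp add: Bochner_Integration.integral_sum corr)
  qed
  finally show ?thesis .
qed

text \<open>Correlations are positive definite because their quadratic forms are integrals of
  squared norms, so Herglotz' theorem applies after division by their value b at lag 0. If b = 0,
  then f vanishes almost everywhere and the null measure serves.\<close>

lemma spectral_measure_exists:
  fixes f :: "'a \<Rightarrow> complex"
  assumes f: "continuous_on UNIV f"
  obtains \<tau> where "is_spectral_measure T P f \<tau>"
proof -
  define b where "b = (\<integral>x. (norm (f x))\<^sup>2 \<partial>P)"
  have b0: "b \<ge> 0" by (simp add: b_def)
  have c0: "correlation f 0 = of_real b"
    using integral_norm_sum[OF f, of "\<lambda>_. 1" "{0}"] by (simp add: b_def)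
  show thesis
  proof (cases "b = 0")
    case True
    have "integrable P (\<lambda>x. (norm (f x))\<^sup>2)" using f by (intro integrable_P continuous_intros)
    then have "AE x in P. (norm (f x))\<^sup>2 = 0"
      using True by (simp add: b_def integral_nonneg_eq_0_iff_AE)
    then have "AE x in P. f (iter T k x) * cnj (f x) = 0" for k by eventually_elim simp
    then have "(\<integral>x. f (iter T k x) * cnj (f x) \<partial>P) = 0" for k by (rule integral_eq_zero_AE)
    then have "is_spectral_measure T P f (null_measure circle_borel)"
      by (auto simp: is_spectral_measure_def intro!: finite_measureI)
    then show thesis by (rule that)
  next
    case False
    then have b: "b > 0" using b0 by simp
    define c where "c k = correlation f k / of_real b" for k
    have c1: "c 0 = 1" using c0 b by (simp add: c_def)
    have pos: "(\<Sum>i<n. \<Sum>j<n. z i * cnj (z j) * c (int i - int j)) \<in> \<real>\<^sub>\<ge>\<^sub>0"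
      for n and z :: "nat \<Rightarrow> complex"
    proof -
      have "(\<Sum>i<n. \<Sum>j<n. z i * cnj (z j) * c (int i - int j)) =
          of_real ((\<integral>x. (norm (\<Sum>i<n. z i * f ((T ^^ i) x)))\<^sup>2 \<partial>P) / b)"
        using integral_norm_sum[OF f, of z "{..<n}"] by (simp add: c_def sum_divide_distrib)
      then show ?thesis using b by (simp only: nonneg_Reals_of_real_iff) simp
    qed
    obtain \<sigma> where \<sigma>: "sets \<sigma> = sets circle_borel" "prob_space \<sigma>"
      "\<And>k::int. (\<integral>t. cis (- (of_int k * t)) \<partial>\<sigma>) = c k"
      by (rule herglotz[OF pos c1]) (rule that)
    interpret \<sigma>: prob_space \<sigma> by fact
    define \<tau> where "\<tau> = density \<sigma> (\<lambda>_. ennreal b)"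
    have "is_spectral_measure T P f \<tau>"
      unfolding is_spectral_measure_def
    proof (intro conjI allI)
      show "sets \<tau> = sets circle_borel" by (simp add: \<tau>_def \<sigma>)
      show "finite_measure \<tau>"
        by (rule finite_measureI) (simp add: \<tau>_def emeasure_density \<sigma>.emeasure_space_1 ennreal_mult_eq_top_iff)
      fix k :: int
      have "(\<lambda>t. cis (- (of_int k * t))) \<in> borel_measurable \<sigma>"
        using \<sigma>(1) by (rule measurable_circle) measurable
      then have "(\<integral>t. cis (- (of_int k * t)) \<partial>\<tau>) = (\<integral>t. b *\<^sub>R cis (- (of_int k * t)) \<partial>\<sigma>)"
        unfolding \<tau>_def using b by (intro integral_density) auto
      also have "\<dots> = correlation f k" using b by (simp add: \<sigma>(3) c_def scaleR_conv_of_real)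
      finally show "(\<integral>t. cis (- (of_int k * t)) \<partial>\<tau>) = (\<integral>x. f (iter T k x) * cnj (f x) \<partial>P)"
        by (simp add: correlation_def)
    qed
    then show thesis by (rule that)
  qed
qed

text \<open>Both sides expand to the same quadratic form in the coefficients. The argument is
  \<open>cis (- t)\<close> because spectral measures here pair the k-th iterate of T with
  \<open>cis (- (k * t))\<close>.\<close>

lemma spectral_isometry:
  fixes f :: "'a \<Rightarrow> complex" and p :: "complex poly"
  assumes f: "continuous_on UNIV f" and \<tau>: "is_spectral_measure T P f \<tau>"
  shows "(\<integral>x. (norm (\<Sum>k\<le>degree p. coeff p k * f ((T ^^ k) x)))\<^sup>2 \<partial>P) =
    (\<integral>t. (norm (poly p (cis (- t))))\<^sup>2 \<partial>\<tau>)"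
proof -
  have sets\<tau>: "sets \<tau> = sets circle_borel" and "finite_measure \<tau>"
    and corr: "\<And>k::int. (\<integral>t. cis (- (of_int k * t)) \<partial>\<tau>) = correlation f k"
    using \<tau> by (auto simp: is_spectral_measure_def correlation_def)
  interpret \<tau>: finite_measure \<tau> by fact
  have icis: "integrable \<tau> (\<lambda>t. cis (- (a * t)))" for a
    by (intro \<tau>.integrable_const_bound[where B=1] measurable_circle[OF sets\<tau>]) auto
  have expand: "complex_of_real ((norm (poly p (cis (- t))))\<^sup>2) =
      (\<Sum>i\<le>degree p. \<Sum>j\<le>degree p. (coeff p i * cnj (coeff p j)) * cis (- (of_int (int i - int j) * t)))" for t
    unfolding poly_altdef norm_sum_squared
    by (intro sum.cong refl) (simp add: Complex.DeMoivre cis_cnj cis_mult algebra_simps)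
  have "complex_of_real (\<integral>t. (norm (poly p (cis (- t))))\<^sup>2 \<partial>\<tau>) =
      (\<integral>t. complex_of_real ((norm (poly p (cis (- t))))\<^sup>2) \<partial>\<tau>)"
    by (rule integral_complex_of_real[symmetric])
  also have "\<dots> = (\<Sum>i\<le>degree p. \<Sum>j\<le>degree p. (coeff p i * cnj (coeff p j)) * correlation f (int i - int j))"
    unfolding expand using icis
    by (simp add: Bochner_Integration.integral_sum corr del: of_int_diff)
  also have "\<dots> = complex_of_real (\<integral>x. (norm (\<Sum>k\<le>degree p. coeff p k * f ((T ^^ k) x)))\<^sup>2 \<partial>P)"
    by (rule integral_norm_sum[OF f, symmetric])
  finally show ?thesis by (simp only: of_real_eq_iff)
qed

end

lemma uniquely_ergodic_compact_system:
  fixes T :: "'a::metric_space \<Rightarrow> 'a"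
  assumes "uniquely_ergodic T P"
  shows "compact_system T P"
proof
  show "compact (UNIV :: 'a set)" using assms by (simp add: uniquely_ergodic_def)
  obtain S where S: "homeomorphism UNIV UNIV T S" using assms by (auto simp: uniquely_ergodic_def)
  then have "inv T = S" by (intro inv_equality) (auto simp: homeomorphism_def)
  with S show "homeomorphism UNIV UNIV T (inv T)" by simp
  have P: "prob_space P" "sets P = sets borel" "distr P P T = P"
    using assms by (auto simp: uniquely_ergodic_def ergodic_measure_def)
  moreover have "distr P borel T = distr P P T" by (rule distr_cong) (auto simp: P)
  ultimately show "invariant_prob T P" by (simp add: invariant_prob_def)
qed

section \<open>Orthogonality to sequences with Lebesgue spectrum\<close>

lemma mean_Cauchy_Schwarz:
  fixes a b :: "nat \<Rightarrow> complex"
  shows "norm ((\<Sum>n\<in>A. a n * b n) / of_nat N) \<le>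
    sqrt ((\<Sum>n\<in>A. (norm (a n))\<^sup>2) / N) * sqrt ((\<Sum>n\<in>A. (norm (b n))\<^sup>2) / N)"
proof -
  have "norm (\<Sum>n\<in>A. a n * b n) \<le> (\<Sum>n\<in>A. \<bar>norm (a n)\<bar> * \<bar>norm (b n)\<bar>)"
    by (rule order_trans[OF norm_sum]) (simp add: norm_mult)
  also have "\<dots> \<le> sqrt (\<Sum>n\<in>A. (norm (a n))\<^sup>2) * sqrt (\<Sum>n\<in>A. (norm (b n))\<^sup>2)"
    using L2_set_mult_ineq[of "\<lambda>n. norm (a n)" "\<lambda>n. norm (b n)" A] by (simp add: L2_set_def)
  finally have "norm (\<Sum>n\<in>A. a n * b n) / N \<le>
      sqrt (\<Sum>n\<in>A. (norm (a n))\<^sup>2) * sqrt (\<Sum>n\<in>A. (norm (b n))\<^sup>2) / N"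
    by (rule divide_right_mono) simp
  moreover have "sqrt (real N) * sqrt (real N) = real N" by simp
  ultimately show ?thesis
    by (simp add: norm_divide real_sqrt_divide del: real_sqrt_mult_self)
qed

text \<open>Since \<open>u 0 = 0\<close>, truncated subtraction in \<open>u (m - j)\<close> amounts to extending u by 0 to the
  negative integers.\<close>

lemma shifted_correlation:
  fixes u :: "nat \<Rightarrow> real"
  assumes u0: "u 0 = 0"
    and corr: "\<And>h. (\<lambda>N. (\<Sum>n=1..N. u n * u (n + h)) / real N) \<longlonglongrightarrow> (if h \<noteq> 0 then 0 else L)"
  shows "(\<lambda>N. (\<Sum>m=1..N. u (m - j) * u (m - k)) / real N) \<longlonglongrightarrow> (if j = k then L else 0)"
proof -
  have main: "(\<lambda>N. (\<Sum>m=1..N. u (m - j) * u (m - k)) / real N) \<longlonglongrightarrow> (if j = k then L else 0)"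
    if "j \<le> k" for j k
  proof (rule LIMSEQ_offset[where k=k])
    let ?X = "\<lambda>N. (\<Sum>n=1..N. u n * u (n + (k - j))) / real N"
    \<comment> \<open>In a sum up to N + k the first k terms vanish, as \<open>u (m - k)\<close> is
      then \<open>u 0\<close>. What remains is an unshifted sum of length N; the factor is N/(N +
      k), the change of normalisation.\<close>
    have "(\<lambda>N. ?X N * (1 - real k * (1 / real (N + k)))) \<longlonglongrightarrow> (if k - j \<noteq> 0 then 0 else L) * (1 - real k * 0)"
      by (intro tendsto_intros corr LIMSEQ_ignore_initial_segment[OF lim_1_over_n])
    moreover have "(if k - j \<noteq> 0 then 0 else L) * (1 - real k * 0) = (if j = k then L else 0)"
      using that by auto
    moreover have "\<forall>\<^sub>F N in sequentially. ?X N * (1 - real k * (1 / real (N + k))) =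
        (\<Sum>m=1..N + k. u (m - j) * u (m - k)) / real (N + k)"
      using eventually_gt_at_top[of 0]
    proof eventually_elim
      fix N :: nat assume N: "N > 0"
      have "(\<Sum>m=1..N + k. u (m - j) * u (m - k)) = (\<Sum>m=1+k..N+k. u (m - j) * u (m - k))"
        using u0 by (intro sum.mono_neutral_right) auto
      also have "\<dots> = (\<Sum>n=1..N. u (n + k - j) * u (n + k - k))"
        by (rule sum.shift_bounds_cl_nat_ivl)
      also have "\<dots> = (\<Sum>n=1..N. u n * u (n + (k - j)))"
        using that by (intro sum.cong refl) (simp add: mult.commute)
      finally have "(\<Sum>m=1..N + k. u (m - j) * u (m - k)) = (\<Sum>n=1..N. u n * u (n + (k - j)))" .
      moreover have "1 - real k * (1 / real (N + k)) = real N / real (N + k)"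
        using N by (simp add: field_simps)
      ultimately show "?X N * (1 - real k * (1 / real (N + k))) =
        (\<Sum>m=1..N + k. u (m - j) * u (m - k)) / real (N + k)"
        using N by simp
    qed
    ultimately show "(\<lambda>N. (\<Sum>m=1..N + k. u (m - j) * u (m - k)) / real (N + k)) \<longlonglongrightarrow> (if j = k then L else 0)"
      using Lim_transform_eventually by fastforce
  qed
  show ?thesis
  proof (cases "j \<le> k")
    case False
    then show ?thesis using main[of k j] by (simp add: mult.commute eq_commute)
  qed (rule main)
qed

text \<open>The counterpart of \<open>parseval_poly\<close> for u: the shifts of u are
  asymptotically orthogonal with mean square L, so only the diagonal of the expanded square survives
  in the limit.\<close>

lemma mean_square_filtered:
  fixes u :: "nat \<Rightarrow> real" and a :: "nat \<Rightarrow> complex"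
  assumes u0: "u 0 = 0"
    and corr: "\<And>h. (\<lambda>N. (\<Sum>n=1..N. u n * u (n + h)) / real N) \<longlonglongrightarrow> (if h \<noteq> 0 then 0 else L)"
  shows "(\<lambda>N. (\<Sum>m=1..N. (norm (\<Sum>k\<le>d. a k * of_real (u (m - k))))\<^sup>2) / real N)
    \<longlonglongrightarrow> L * (\<Sum>k\<le>d. (norm (a k))\<^sup>2)"
proof -
  have "(\<lambda>N. \<Sum>i\<le>d. \<Sum>j\<le>d. a i * cnj (a j) * of_real ((\<Sum>m=1..N. u (m - i) * u (m - j)) / real N))
      \<longlonglongrightarrow> (\<Sum>i\<le>d. \<Sum>j\<le>d. a i * cnj (a j) * of_real (if i = j then L else 0))"
    by (intro tendsto_intros shifted_correlation u0 corr)
  moreover have "(\<Sum>i\<le>d. \<Sum>j\<le>d. a i * cnj (a j) * of_real ((\<Sum>m=1..N. u (m - i) * u (m - j)) / real N)) =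
      of_real ((\<Sum>m=1..N. (norm (\<Sum>k\<le>d. a k * of_real (u (m - k))))\<^sup>2) / real N)" for N
  proof -
    have "complex_of_real (\<Sum>m=1..N. (norm (\<Sum>k\<le>d. a k * of_real (u (m - k))))\<^sup>2) =
        (\<Sum>m=1..N. \<Sum>i\<le>d. \<Sum>j\<le>d. a i * cnj (a j) * of_real (u (m - i) * u (m - j)))"
      unfolding of_real_sum norm_sum_squared by (intro sum.cong refl) simp
    also have "\<dots> = (\<Sum>i\<le>d. \<Sum>j\<le>d. \<Sum>m=1..N. a i * cnj (a j) * of_real (u (m - i) * u (m - j)))"
      by (subst sum.swap, rule sum.cong[OF refl], rule sum.swap)
    finally have eq: "complex_of_real (\<Sum>m=1..N. (norm (\<Sum>k\<le>d. a k * of_real (u (m - k))))\<^sup>2) = \<dots>" .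
    have "(\<Sum>i\<le>d. \<Sum>j\<le>d. a i * cnj (a j) * of_real ((\<Sum>m=1..N. u (m - i) * u (m - j)) / real N)) =
        (\<Sum>i\<le>d. \<Sum>j\<le>d. \<Sum>m=1..N. a i * cnj (a j) * of_real (u (m - i) * u (m - j))) / of_nat N"
      by (simp add: sum_divide_distrib sum_distrib_left)
    then show ?thesis
      unfolding eq[symmetric] by (simp only: of_real_divide of_real_of_nat_eq)
  qed
  moreover have "(\<Sum>i\<le>d. \<Sum>j\<le>d. a i * cnj (a j) * of_real (if i = j then L else 0)) =
      of_real (L * (\<Sum>k\<le>d. (norm (a k))\<^sup>2))"
  proof -
    have "(\<Sum>j\<le>d. a i * cnj (a j) * of_real (if i = j then L else 0)) = of_real L * of_real ((norm (a i))\<^sup>2)"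
      if "i \<le> d" for i
    proof -
      have "(\<Sum>j\<le>d. a i * cnj (a j) * of_real (if i = j then L else 0)) =
          (\<Sum>j\<le>d. if i = j then a i * cnj (a j) * of_real L else 0)"
        by (intro sum.cong) auto
      also have "\<dots> = a i * cnj (a i) * of_real L" using that by (subst sum.delta') auto
      finally show ?thesis by (simp only: complex_norm_square mult.commute)
    qed
    then show ?thesis by (simp add: sum_distrib_left)
  qed
  ultimately show ?thesis by (simp only: tendsto_of_real_iff)
qed

text \<open>The polynomial approximation for the spectral measure of f, carried over by the isometry
  applied to the difference of the monomial of degree K and p. Absolute continuity with respect to a
  singular maximal spectral measure makes the spectral measure of f singular as well.\<close>

lemma (in compact_system) singular_spectrum_approximation:
  fixes f :: "'a \<Rightarrow> complex"
  assumes sing: "singular_spectrum T P" and f: "continuous_on UNIV f" and e: "e > 0"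
  obtains K d and a :: "nat \<Rightarrow> complex"
  where "(\<integral>x. (norm (f ((T ^^ K) x) - (\<Sum>k\<le>d. a k * f ((T ^^ k) x))))\<^sup>2 \<partial>P) < e"
    "(\<Sum>k\<le>d. (norm (a k))\<^sup>2) < e"
proof -
  obtain \<sigma> where \<sigma>: "maximal_spectral_measure T P \<sigma>" "mutually_singular \<sigma> circle_lebesgue"
    using sing unfolding singular_spectrum_def by blast
  obtain \<tau> where \<tau>: "is_spectral_measure T P f \<tau>" using spectral_measure_exists[OF f] by blast
  have "f \<in> L2 P"
    using f borel_measurable_continuous_onI[OF f]
    by (auto simp: L2_def measurable_borel_iff[OF sets_P] intro!: integrable_P continuous_intros)
  then have ac: "absolutely_continuous \<sigma> \<tau>" using \<sigma>(1) \<tau> by (simp add: maximal_spectral_measure_def)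
  have s: "sets \<sigma> = sets circle_borel" "sets \<tau> = sets circle_borel" "finite_measure \<tau>"
    using \<sigma>(1) \<tau> by (auto simp: maximal_spectral_measure_def is_spectral_measure_def)
  obtain A where A: "A \<in> sets \<sigma>" "emeasure \<sigma> A = 0" "emeasure circle_lebesgue (space circle_lebesgue - A) = 0"
    using \<sigma>(2) unfolding mutually_singular_def by blast
  have "A \<in> null_sets \<tau>" using A ac by (auto simp: absolutely_continuous_def null_sets_def)
  then have \<tau>A: "emeasure \<tau> A = 0" by auto
  have sp: "space circle_lebesgue = space \<tau>" "space circle_borel = space \<tau>" "space \<tau> = {0..<2 * pi}"
    using sets_eq_imp_space_eq[OF s(2)]
    by (auto simp: circle_lebesgue_def circle_borel_def space_restrict_space)
  have A\<tau>: "A \<in> sets \<tau>" using A s by simp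
  \<comment> \<open>A is null for \<open>\<sigma>\<close>, hence for \<open>\<tau>\<close>, so its
    complement carries \<open>\<tau>\<close>; singularity makes that complement Lebesgue
    null.\<close>
  let ?B = "space \<tau> - A"
  have "?B \<in> sets circle_borel" using A\<tau> s(2) by auto
  moreover have "emeasure \<tau> (space \<tau> - ?B) = 0"
    using \<tau>A sets.sets_into_space[OF A\<tau>] by (simp add: double_diff)
  moreover have "emeasure circle_lebesgue ?B = 0" using A(3) sp by simp
  ultimately obtain K p where p:
    "(\<integral>t. (norm (cis (- t) ^ K - poly p (cis (- t))))\<^sup>2 \<partial>\<tau>) < e"
    "(\<Sum>k\<le>degree p. (norm (coeff p k))\<^sup>2) < e"
    using singular_poly_approximation[OF s(2,3) _ _ _ e] by blast
  show thesis
  proof (rule that[of K "coeff p" "degree p"])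
    define q where "q = monom 1 K - p"
    \<comment> \<open>A common summation range, since the degree of a difference need not be the
      larger degree; the coefficients added are 0.\<close>
    define D where "D = max K (max (degree p) (degree q))"
    have ext: "(\<Sum>k\<le>degree r. coeff r k * F k) = (\<Sum>k\<le>D. coeff r k * F k)"
      if "degree r \<le> D" for r :: "complex poly" and F
      using that by (intro sum.mono_neutral_left) (auto simp: coeff_eq_0 not_le)
    have "(\<Sum>k\<le>degree q. coeff q k * f ((T ^^ k) x)) = f ((T ^^ K) x) - (\<Sum>k\<le>degree p. coeff p k * f ((T ^^ k) x))" for x
    proof -
      have "(\<Sum>k\<le>degree q. coeff q k * f ((T ^^ k) x)) =
          (\<Sum>k\<le>D. (if k = K then f ((T ^^ k) x) else 0) - coeff p k * f ((T ^^ k) x))"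
        by (subst ext) (auto simp: D_def q_def left_diff_distrib intro!: sum.cong)
      also have "\<dots> = f ((T ^^ K) x) - (\<Sum>k\<le>D. coeff p k * f ((T ^^ k) x))"
        by (simp add: sum_subtractf D_def)
      also have "(\<Sum>k\<le>D. coeff p k * f ((T ^^ k) x)) = (\<Sum>k\<le>degree p. coeff p k * f ((T ^^ k) x))"
        by (rule ext[symmetric]) (simp add: D_def)
      finally show ?thesis .
    qed
    then show "(\<integral>x. (norm (f ((T ^^ K) x) - (\<Sum>k\<le>degree p. coeff p k * f ((T ^^ k) x))))\<^sup>2 \<partial>P) < e"
      using spectral_isometry[OF f \<tau>, of q] p(1) by (simp add: q_def poly_monom)
  qed (rule p)
qed

text \<open>The correlation hypothesis says that u has L times Lebesgue measure as its spectral
  measure, so f and u have mutually singular spectra. The average splits into the remainder paired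
  with the bounded u, the bounded f paired with the filtered u, and boundary terms; each is made at
  most a quarter of \<open>\<epsilon>\<close>.\<close>

theorem singular_spectrum_orthogonal:
  fixes T :: "'a::metric_space \<Rightarrow> 'a" and f :: "'a \<Rightarrow> complex" and u :: "nat \<Rightarrow> real"
  assumes ue: "uniquely_ergodic T P" and sing: "singular_spectrum T P" and f: "continuous_on UNIV f"
    and u0: "u 0 = 0" and u1: "\<And>n. \<bar>u n\<bar> \<le> 1"
    and corr: "\<And>h. (\<lambda>N. (\<Sum>n=1..N. u n * u (n + h)) / real N) \<longlonglongrightarrow> (if h \<noteq> 0 then 0 else L)"
  shows "(\<lambda>N. (\<Sum>n=1..N. f ((T ^^ n) x) * of_real (u n)) / of_nat N) \<longlonglongrightarrow> 0"
proof (rule tendstoI)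
  fix \<epsilon> :: real assume "\<epsilon> > 0"
  interpret compact_system T P by (rule uniquely_ergodic_compact_system[OF ue])
  have L0: "L \<ge> 0"
  proof (rule LIMSEQ_le_const)
    show "(\<lambda>N. (\<Sum>n=1..N. u n * u n) / real N) \<longlonglongrightarrow> L" using corr[of 0] by simp
    show "\<exists>M. \<forall>N\<ge>M. 0 \<le> (\<Sum>n=1..N. u n * u n) / real N" by (auto intro!: sum_nonneg divide_nonneg_nonneg)
  qed
  obtain B0 where "\<And>x. norm (f x) \<le> B0"
    using compact_imp_bounded[OF compact_continuous_image[OF f compact_space]] by (auto simp: bounded_iff)
  then obtain B where B: "\<And>x. norm (f x) \<le> B" "B > 0"
    by (metis gt_ex le_less_trans less_imp_le max_less_iff_conj order_trans)
  define \<delta> where "\<delta> = \<epsilon> / 4"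
  have \<delta>: "\<delta> > 0" using \<open>\<epsilon> > 0\<close> by (simp add: \<delta>_def)
  \<comment> \<open>The mean square of the remainder will be below 2e, one e from the approximation
    and one from the time average. That of the filtered sequence will be below (L + 1)e, and it
    meets the bound B for f.\<close>
  define e where "e = min (\<delta>\<^sup>2 / 2) (\<delta>\<^sup>2 / (B\<^sup>2 * (L + 1)))"
  have BL: "B\<^sup>2 * (L + 1) > 0" using B L0 by (intro mult_pos_pos) auto
  have e: "e > 0" "2 * e \<le> \<delta>\<^sup>2" using \<delta> BL by (auto simp: e_def)
  have e2: "B\<^sup>2 * ((L + 1) * e) \<le> \<delta>\<^sup>2"
  proof -
    have "e \<le> \<delta>\<^sup>2 / (B\<^sup>2 * (L + 1))" by (simp add: e_def)
    then show ?thesis using BL by (simp add: pos_le_divide_eq mult_ac)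
  qed
  obtain K d and a :: "nat \<Rightarrow> complex" where
    a1: "(\<integral>x. (norm (f ((T ^^ K) x) - (\<Sum>k\<le>d. a k * f ((T ^^ k) x))))\<^sup>2 \<partial>P) < e"
    and a2: "(\<Sum>k\<le>d. (norm (a k))\<^sup>2) < e"
    using singular_spectrum_approximation[OF sing f e(1)] by blast
  \<comment> \<open>The approximation concerns f after K steps, so the orbit is restarted K steps
    before x: the value of f at the n-th iterate of x is then G at the n-th iterate of y plus terms
    at later iterates of y.\<close>
  define y where "y = (inv T ^^ K) x"
  have Ty: "(T ^^ K) y = x"
    unfolding y_def using fn_o_inv_fn_is_id[OF bij_T, of K] by (metis comp_apply)
  define G where "G z = f ((T ^^ K) z) - (\<Sum>k\<le>d. a k * f ((T ^^ k) z))" for z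
  define V where "V m = (\<Sum>k\<le>d. a k * complex_of_real (u (m - k)))" for m
  \<comment> \<open>Moving the shift by k from f to u leaves k boundary terms beyond N, each of norm
    at most B; terms at the lower end vanish by \<open>u 0 = 0\<close>.\<close>
  define C where "C = (\<Sum>k\<le>d. norm (a k) * (real k * B))"
  have cf: "continuous_on UNIV (\<lambda>x. f ((T ^^ i) x))" for i
    using continuous_on_compose2[OF f continuous_funpow[OF continuous_T]] by simp
  have cG: "continuous_on UNIV (\<lambda>z. (norm (G z))\<^sup>2)"
    unfolding G_def using cf by (intro continuous_intros)
  have split: "norm ((\<Sum>n=1..N. f ((T ^^ n) x) * of_real (u n)) / of_nat N) \<le>
      norm ((\<Sum>n=1..N. G ((T ^^ n) y) * of_real (u n)) / of_nat N) +
      norm ((\<Sum>m=1..N. f ((T ^^ m) y) * V m) / of_nat N) + C / N" for N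
  proof -
    define R where "R k = (\<Sum>m=N+1..N+k. f ((T ^^ m) y) * complex_of_real (u (m - k)))" for k
    have fx: "f ((T ^^ n) x) = G ((T ^^ n) y) + (\<Sum>k\<le>d. a k * f ((T ^^ (n + k)) y))" for n
    proof -
      have "(T ^^ n) x = (T ^^ K) ((T ^^ n) y)"
        unfolding Ty[symmetric] by (metis comp_apply funpow_add add.commute)
      moreover have "(T ^^ (n + k)) y = (T ^^ k) ((T ^^ n) y)" for k
        by (metis comp_apply funpow_add add.commute)
      ultimately show ?thesis by (simp add: G_def)
    qed
    have shift: "(\<Sum>n=1..N. f ((T ^^ (n + k)) y) * complex_of_real (u n)) =
        (\<Sum>m=1..N. f ((T ^^ m) y) * complex_of_real (u (m - k))) + R k" for k
    proof -
      have "(\<Sum>n=1..N. f ((T ^^ (n + k)) y) * complex_of_real (u n)) =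
          (\<Sum>n=1..N. f ((T ^^ (n + k)) y) * complex_of_real (u (n + k - k)))" by simp
      also have "\<dots> = (\<Sum>m=1+k..N+k. f ((T ^^ m) y) * complex_of_real (u (m - k)))"
        by (rule sum.shift_bounds_cl_nat_ivl[symmetric])
      also have "\<dots> = (\<Sum>m=1..N+k. f ((T ^^ m) y) * complex_of_real (u (m - k)))"
        using u0 by (intro sum.mono_neutral_left) auto
      also have "\<dots> = (\<Sum>m=1..N. f ((T ^^ m) y) * complex_of_real (u (m - k))) + R k"
        unfolding R_def by (rule sum.ub_add_nat) simp
      finally show ?thesis .
    qed
    have "norm (R k) \<le> real k * B" for k
    proof -
      have "norm (R k) \<le> (\<Sum>m=N+1..N+k. B)" unfolding R_def
      proof (rule sum_norm_le)
        fix m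
        have "norm (f ((T ^^ m) y)) * \<bar>u (m - k)\<bar> \<le> B * 1"
          using B u1 by (intro mult_mono) auto
        then show "norm (f ((T ^^ m) y) * complex_of_real (u (m - k))) \<le> B" by (simp add: norm_mult)
      qed
      then show ?thesis by simp
    qed
    then have RC: "norm (\<Sum>k\<le>d. a k * R k) \<le> C"
      unfolding C_def by (intro sum_norm_le) (auto simp: norm_mult intro!: mult_left_mono)
    have "(\<Sum>n=1..N. f ((T ^^ n) x) * of_real (u n)) =
        (\<Sum>n=1..N. G ((T ^^ n) y) * of_real (u n)) +
        (\<Sum>n=1..N. \<Sum>k\<le>d. a k * (f ((T ^^ (n + k)) y) * of_real (u n)))"
      unfolding fx by (simp add: distrib_right sum.distrib sum_distrib_right mult.assoc)
    also have "(\<Sum>n=1..N. \<Sum>k\<le>d. a k * (f ((T ^^ (n + k)) y) * of_real (u n))) =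
        (\<Sum>k\<le>d. a k * (\<Sum>n=1..N. f ((T ^^ (n + k)) y) * of_real (u n)))"
      by (subst sum.swap) (simp add: sum_distrib_left)
    also have "\<dots> = (\<Sum>k\<le>d. \<Sum>m=1..N. a k * (f ((T ^^ m) y) * of_real (u (m - k)))) + (\<Sum>k\<le>d. a k * R k)"
      unfolding shift by (simp add: distrib_left sum.distrib sum_distrib_left)
    also have "(\<Sum>k\<le>d. \<Sum>m=1..N. a k * (f ((T ^^ m) y) * of_real (u (m - k)))) = (\<Sum>m=1..N. f ((T ^^ m) y) * V m)"
      unfolding V_def by (subst sum.swap) (simp add: sum_distrib_left mult_ac)
    finally have eq: "(\<Sum>n=1..N. f ((T ^^ n) x) * of_real (u n)) / of_nat N =
        (\<Sum>n=1..N. G ((T ^^ n) y) * of_real (u n)) / of_nat N +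
        (\<Sum>m=1..N. f ((T ^^ m) y) * V m) / of_nat N + (\<Sum>k\<le>d. a k * R k) / of_nat N"
      by (simp add: add_divide_distrib add.assoc)
    have "norm ((\<Sum>k\<le>d. a k * R k) / of_nat N) \<le> C / N"
      using RC by (simp add: norm_divide divide_right_mono)
    then show ?thesis unfolding eq by (intro norm_triangle_mono order_refl)
  qed
  have ev1: "\<forall>\<^sub>F N in sequentially. (\<Sum>n=1..N. (norm (G ((T ^^ n) y)))\<^sup>2) / N < (\<integral>z. (norm (G z))\<^sup>2 \<partial>P) + e"
    by (rule uniquely_ergodic_time_average[OF ue cG e(1)])
  have ev2: "\<forall>\<^sub>F N in sequentially. (\<Sum>m=1..N. (norm (V m))\<^sup>2) / N < L * (\<Sum>k\<le>d. (norm (a k))\<^sup>2) + e"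
    unfolding V_def using mean_square_filtered[OF u0 corr] e(1) by (intro order_tendstoD(2)) auto
  have "(\<lambda>N. C * (1 / real N)) \<longlonglongrightarrow> C * 0" by (intro tendsto_intros lim_1_over_n)
  then have ev3: "\<forall>\<^sub>F N in sequentially. C * (1 / real N) < \<delta>" using \<delta> by (intro order_tendstoD(2)) auto
  show "\<forall>\<^sub>F N in sequentially. dist ((\<Sum>n=1..N. f ((T ^^ n) x) * of_real (u n)) / of_nat N) 0 < \<epsilon>"
    using ev1 ev2 ev3
  proof eventually_elim
    fix N
    assume 1: "(\<Sum>n=1..N. (norm (G ((T ^^ n) y)))\<^sup>2) / N < (\<integral>z. (norm (G z))\<^sup>2 \<partial>P) + e"
      and 2: "(\<Sum>m=1..N. (norm (V m))\<^sup>2) / N < L * (\<Sum>k\<le>d. (norm (a k))\<^sup>2) + e"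
      and 3: "C * (1 / real N) < \<delta>"
    have mean_le: "(\<Sum>n=1..N. (norm (b n))\<^sup>2) / N \<le> c\<^sup>2" if "\<And>n. norm (b n) \<le> c" for b :: "nat \<Rightarrow> complex" and c
    proof -
      have "(\<Sum>n=1..N. (norm (b n))\<^sup>2) \<le> (\<Sum>n=1..N. c\<^sup>2)"
        using that by (intro sum_mono power_mono) auto
      then show ?thesis by (cases "N = 0") (auto simp: divide_le_eq mult.commute)
    qed
    have "norm ((\<Sum>n=1..N. G ((T ^^ n) y) * of_real (u n)) / of_nat N) \<le>
        sqrt ((\<Sum>n=1..N. (norm (G ((T ^^ n) y)))\<^sup>2) / N) * sqrt ((\<Sum>n=1..N. (norm (complex_of_real (u n)))\<^sup>2) / N)"
      by (rule mean_Cauchy_Schwarz)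
    also have "\<dots> \<le> \<delta> * 1"
    proof (rule mult_mono)
      have "(\<Sum>n=1..N. (norm (G ((T ^^ n) y)))\<^sup>2) / N \<le> \<delta>\<^sup>2" using 1 a1 e(2) by (simp add: G_def)
      then show "sqrt ((\<Sum>n=1..N. (norm (G ((T ^^ n) y)))\<^sup>2) / N) \<le> \<delta>"
        using \<delta> by (intro real_le_lsqrt) auto
      show "sqrt ((\<Sum>n=1..N. (norm (complex_of_real (u n)))\<^sup>2) / N) \<le> 1"
        using mean_le[of "\<lambda>n. complex_of_real (u n)" 1] u1 by simp
    qed (use \<delta> in \<open>auto intro!: divide_nonneg_nonneg sum_nonneg\<close>)
    finally have b1: "norm ((\<Sum>n=1..N. G ((T ^^ n) y) * of_real (u n)) / of_nat N) \<le> \<delta>" by simp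
    have "norm ((\<Sum>m=1..N. f ((T ^^ m) y) * V m) / of_nat N) \<le>
        sqrt ((\<Sum>m=1..N. (norm (f ((T ^^ m) y)))\<^sup>2) / N) * sqrt ((\<Sum>m=1..N. (norm (V m))\<^sup>2) / N)"
      by (rule mean_Cauchy_Schwarz)
    also have "\<dots> \<le> B * sqrt ((L + 1) * e)"
    proof (rule mult_mono)
      show "sqrt ((\<Sum>m=1..N. (norm (f ((T ^^ m) y)))\<^sup>2) / N) \<le> B"
        using mean_le[of "\<lambda>m. f ((T ^^ m) y)" B] B by (intro real_le_lsqrt) auto
      have "L * (\<Sum>k\<le>d. (norm (a k))\<^sup>2) \<le> L * e" using a2 L0 by (intro mult_left_mono) auto
      then show "sqrt ((\<Sum>m=1..N. (norm (V m))\<^sup>2) / N) \<le> sqrt ((L + 1) * e)"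
        using 2 by (intro real_sqrt_le_mono) (simp add: distrib_right)
    qed (use B in \<open>auto intro!: divide_nonneg_nonneg sum_nonneg\<close>)
    also have "\<dots> = sqrt (B\<^sup>2 * ((L + 1) * e))" using B(2) by (simp add: real_sqrt_mult)
    also have "\<dots> \<le> \<delta>" using e2 \<delta> by (intro real_le_lsqrt) auto
    finally have b2: "norm ((\<Sum>m=1..N. f ((T ^^ m) y) * V m) / of_nat N) \<le> \<delta>" .
    have "norm ((\<Sum>n=1..N. f ((T ^^ n) x) * of_real (u n)) / of_nat N) < \<epsilon>"
      using split[of N] b1 b2 3 \<delta> unfolding \<delta>_def times_divide_eq_right mult_1_right by linarith
    then show "dist ((\<Sum>n=1..N. f ((T ^^ n) x) * of_real (u n)) / of_nat N) 0 < \<epsilon>" by simp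
  qed
qed

lemma abs_moebius_mu_le: "\<bar>moebius_mu n\<bar> \<le> 1"
  by (simp add: moebius_mu_def power_abs)

theorem theorem2p7:
  fixes T :: "'a::metric_space \<Rightarrow> 'a" and P :: "'a measure"
    and f :: "'a \<Rightarrow> complex" and x :: 'a
  assumes elliott: "\<And>h::nat.
      (\<lambda>N. (\<Sum>n=1..N. real_of_int (moebius_mu n * moebius_mu (n + h))) / real N)
        \<longlonglongrightarrow> (if h \<noteq> 0 then 0 else 6 / pi\<^sup>2)"
    and "uniquely_ergodic T P"
    and "singular_spectrum T P"
    and "f \<in> C0 P"
  shows "(\<lambda>N. (\<Sum>n=1..N. f ((T ^^ n) x) * of_int (moebius_mu n)) / of_nat N) \<longlonglongrightarrow> 0"
proof -
  have "(\<lambda>N. (\<Sum>n=1..N. f ((T ^^ n) x) * of_real (real_of_int (moebius_mu n))) / of_nat N) \<longlonglongrightarrow> 0"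
  proof (rule singular_spectrum_orthogonal[OF assms(2,3), where L="6 / pi\<^sup>2"])
    show "continuous_on UNIV f" using assms(4) by (simp add: C0_def)
    \<comment> \<open>Since 0 is not squarefree, the value at 0 agrees with the extension by 0 that
      the shifts require.\<close>
    show "real_of_int (moebius_mu 0) = 0" by (simp add: moebius_mu_def)
    show "\<bar>real_of_int (moebius_mu n)\<bar> \<le> 1" for n
      using abs_moebius_mu_le[of n] by linarith
    show "(\<lambda>N. (\<Sum>n=1..N. real_of_int (moebius_mu n) * real_of_int (moebius_mu (n + h))) / real N)
        \<longlonglongrightarrow> (if h \<noteq> 0 then 0 else 6 / pi\<^sup>2)" for h
      using elliott[of h] by simp
  qed
  then show ?thesis by simp
qed

end
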